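(* Let $J$ be an algebra of cardinality $\kappa$ in a language of cardinality $\lambda$. If $\mathrm{cf}(\kappa) > 2^{\lambda^+}$ and $J$ lies in a residually small variety, then $J$ has a proper subalgebra of cardinality $\kappa$.
   Context: An algebra is a set equipped with finitary operations interpreting the operation symbols of an algebraic language. The cardinality of a language is understood to be infinite, i.e. it is the maximum of $\aleph_0$ and the number of operation symbols (so a language with countably many symbols has cardinality $\lambda=\aleph_0$). $\lambda^+$ denotes the successor cardinal of $\lambda$, and $\mathrm{cf}(\kappa)$ is the cofinality of $\kappa$. A variety is a class of algebras in a fixed language (here the language of $J$) defined by a set of identities. A variety is residually small if there is a cardinal bounding the cardinalities of all its subdirectly irreducible members. A subalgebra of $J$ is proper if it is not all of $J$. *)

theory Defs
  imports Main "HOL-Library.FuncSet"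
begin

unbundle cardinal_syntax

section \<open>Languages, algebras, homomorphisms\<close>

record 'f signature =
  syms :: "'f set"
  arity :: "'f \<Rightarrow> nat"

record ('f, 'a) algebra =
  carrier :: "'a set"
  interp :: "'f \<Rightarrow> 'a list \<Rightarrow> 'a"

text \<open>One summand is infinite, so this cardinal sum is the maximum of aleph-zero and the number of
  operation symbols.\<close>

definition lang_card :: "'f signature \<Rightarrow> (nat + 'f) rel" where
  "lang_card \<Sigma> = natLeq +c |syms \<Sigma>|"

definition args :: "'f signature \<Rightarrow> 'f \<Rightarrow> 'a set \<Rightarrow> 'a list set" where
  "args \<Sigma> f A = {xs. length xs = arity \<Sigma> f \<and> set xs \<subseteq> A}"

definition is_algebra :: "'f signature \<Rightarrow> ('f, 'a) algebra \<Rightarrow> bool" where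
  "is_algebra \<Sigma> A \<longleftrightarrow>
     (\<forall>f\<in>syms \<Sigma>. \<forall>xs\<in>args \<Sigma> f (carrier A). interp A f xs \<in> carrier A)"

definition is_subalgebra :: "'f signature \<Rightarrow> ('f, 'a) algebra \<Rightarrow> ('f, 'a) algebra \<Rightarrow> bool" where
  "is_subalgebra \<Sigma> B A \<longleftrightarrow> is_algebra \<Sigma> B \<and> carrier B \<subseteq> carrier A \<and>
     (\<forall>f\<in>syms \<Sigma>. \<forall>xs\<in>args \<Sigma> f (carrier B). interp B f xs = interp A f xs)"

definition proper_subalgebra :: "'f signature \<Rightarrow> ('f, 'a) algebra \<Rightarrow> ('f, 'a) algebra \<Rightarrow> bool" where
  "proper_subalgebra \<Sigma> B A \<longleftrightarrow> is_subalgebra \<Sigma> B A \<and> carrier B \<noteq> carrier A"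

definition hom :: "'f signature \<Rightarrow> ('f, 'a) algebra \<Rightarrow> ('f, 'b) algebra \<Rightarrow> ('a \<Rightarrow> 'b) set" where
  "hom \<Sigma> A B = {h. h ` carrier A \<subseteq> carrier B \<and>
     (\<forall>f\<in>syms \<Sigma>. \<forall>xs\<in>args \<Sigma> f (carrier A). h (interp A f xs) = interp B f (map h xs))}"

definition iso :: "'f signature \<Rightarrow> ('f, 'a) algebra \<Rightarrow> ('f, 'b) algebra \<Rightarrow> ('a \<Rightarrow> 'b) set" where
  "iso \<Sigma> A B = {h \<in> hom \<Sigma> A B. bij_betw h (carrier A) (carrier B)}"

definition product_algebra :: "'i set \<Rightarrow> ('i \<Rightarrow> ('f, 'b) algebra) \<Rightarrow> ('f, 'i \<Rightarrow> 'b) algebra" where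
  "product_algebra I B =
     \<lparr>carrier = (\<Pi>\<^sub>E i\<in>I. carrier (B i)),
      interp = (\<lambda>f xs. \<lambda>i\<in>I. interp (B i) f (map (\<lambda>x. x i) xs))\<rparr>"


section \<open>Subdirectly irreducible algebras\<close>

definition subdirect_embedding ::
    "'f signature \<Rightarrow> ('f, 'a) algebra \<Rightarrow> 'i set \<Rightarrow> ('i \<Rightarrow> ('f, 'b) algebra) \<Rightarrow> ('a \<Rightarrow> 'i \<Rightarrow> 'b) \<Rightarrow> bool"
where
  "subdirect_embedding \<Sigma> A I B e \<longleftrightarrow>
     (\<forall>i\<in>I. is_algebra \<Sigma> (B i)) \<and>
     e \<in> hom \<Sigma> A (product_algebra I B) \<and> inj_on e (carrier A) \<and>
     (\<forall>i\<in>I. (\<lambda>x. e x i) ` carrier A = carrier (B i))"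

text \<open>The factors of a subdirect representation of \<open>A\<close> are homomorphic images of \<open>A\<close>, so up to
  isomorphism they live on the type \<open>'u\<close> of \<open>A\<close>; and factors whose projections have the same
  kernel can be identified, so kernels (binary relations on \<open>'u\<close>) suffice as indices. Hence the
  types of \<open>I\<close> and \<open>B\<close> below are no restriction. The index set may be empty, so algebras with at
  most one element do not count as subdirectly irreducible; this does not affect residual
  smallness.\<close>

definition subdirectly_irreducible :: "'f signature \<Rightarrow> ('f, 'u) algebra \<Rightarrow> bool" where
  "subdirectly_irreducible \<Sigma> A \<longleftrightarrow> is_algebra \<Sigma> A \<and>
     (\<forall>(I :: 'u rel set) (B :: 'u rel \<Rightarrow> ('f, 'u) algebra) e.
        subdirect_embedding \<Sigma> A I B e \<longrightarrow> (\<exists>i\<in>I. (\<lambda>x. e x i) \<in> iso \<Sigma> A (B i)))"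


section \<open>Varieties and residual smallness\<close>

datatype 'f trm = Var nat | App 'f "'f trm list"

fun wf_trm :: "'f signature \<Rightarrow> 'f trm \<Rightarrow> bool" where
  "wf_trm \<Sigma> (Var n) \<longleftrightarrow> True"
| "wf_trm \<Sigma> (App f ts) \<longleftrightarrow> f \<in> syms \<Sigma> \<and> length ts = arity \<Sigma> f \<and> (\<forall>t\<in>set ts. wf_trm \<Sigma> t)"

fun trm_val :: "('f, 'a) algebra \<Rightarrow> (nat \<Rightarrow> 'a) \<Rightarrow> 'f trm \<Rightarrow> 'a" where
  "trm_val A v (Var n) = v n"
| "trm_val A v (App f ts) = interp A f (map (trm_val A v) ts)"

definition identities :: "'f signature \<Rightarrow> ('f trm \<times> 'f trm) set" where
  "identities \<Sigma> = {(s, t). wf_trm \<Sigma> s \<and> wf_trm \<Sigma> t}"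

definition satisfies :: "('f, 'a) algebra \<Rightarrow> 'f trm \<times> 'f trm \<Rightarrow> bool" where
  "satisfies A p \<longleftrightarrow>
     (\<forall>v. range v \<subseteq> carrier A \<longrightarrow> trm_val A v (fst p) = trm_val A v (snd p))"

text \<open>A variety is represented by a set \<open>E\<close> of identities defining it; \<open>variety \<Sigma> E\<close>, used at
  type \<open>'a\<close>, is the part of that class consisting of the algebras carried by subsets of
  \<open>'a\<close>.\<close>

definition variety :: "'f signature \<Rightarrow> ('f trm \<times> 'f trm) set \<Rightarrow> ('f, 'a) algebra set" where
  "variety \<Sigma> E = {A. is_algebra \<Sigma> A \<and> (\<forall>p\<in>E. satisfies A p)}"

text \<open>No formula of HOL quantifies over all algebras on all types, so residual smallness is
  expressed on a universe type \<open>'u\<close>, and the bound \<open>\<rho>\<close> has to be strictly smaller than that universe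
  (otherwise the condition would be void).

  If the subdirectly irreducible members of the whole class are bounded by some cardinal, then the
  condition holds on every large enough \<open>'u\<close>: enlarge the bound so that it is at least the
  cardinality of the language, and take \<open>'u\<close> strictly larger. Conversely, the condition on a single
  \<open>'u\<close> bounds the subdirectly irreducible members on all types. Indeed, suppose a subdirectly
  irreducible member \<open>A\<close> had more than \<open>\<rho>\<close> elements. Pick two distinct elements \<open>c\<close> and \<open>d\<close> that are
  identified by every nontrivial congruence of \<open>A\<close>. As \<open>lang_card \<Sigma> \<le>o \<rho>\<close>, there is a subalgebra
  of cardinality exactly the successor of \<open>\<rho>\<close> that contains \<open>c\<close> and \<open>d\<close> and, for all distinct
  elements \<open>x\<close> and \<open>y\<close> of it, a Maltsev chain placing \<open>(c, d)\<close> in the congruence generated by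
  \<open>(x, y)\<close>. This subalgebra is subdirectly irreducible and has a copy on \<open>'u\<close>.\<close>

definition residually_small :: "'u itself \<Rightarrow> 'f signature \<Rightarrow> ('f trm \<times> 'f trm) set \<Rightarrow> bool" where
  "residually_small (_ :: 'u itself) \<Sigma> E \<longleftrightarrow>
     (\<exists>\<rho> :: 'u rel. Card_order \<rho> \<and> lang_card \<Sigma> \<le>o \<rho> \<and> \<rho> <o |UNIV :: 'u set| \<and>
        (\<forall>A \<in> (variety \<Sigma> E :: ('f, 'u) algebra set).
           subdirectly_irreducible \<Sigma> A \<longrightarrow> |carrier A| \<le>o \<rho>))"


section \<open>Cofinality\<close>

text \<open>The predicate \<open>cofinal\<close> of the library asks for strictly larger elements, so an order with
  a greatest element has no cofinal set in that sense. The non-strict version below makes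
  \<open>cofinality\<close> meaningful for finite cardinals as well; for infinite cardinals the two
  agree.\<close>

definition unbounded :: "'a set \<Rightarrow> 'a rel \<Rightarrow> bool" where
  "unbounded S r \<longleftrightarrow> S \<subseteq> Field r \<and> (\<forall>a\<in>Field r. \<exists>b\<in>S. (a, b) \<in> r)"

definition cofinality :: "'a rel \<Rightarrow> 'a rel" where
  "cofinality r = |SOME S. unbounded S r \<and> (\<forall>T. unbounded T r \<longrightarrow> |S| \<le>o |T| )|"

end

theory Submission
  imports Defs HOL.Filter
begin

text \<open>Write \<open>\<lambda>\<close> for the cardinality of the language, \<open>\<kappa>\<close> for that of \<open>J\<close>, and call a congruence coarse if
  it has at most \<open>2 ^ \<lambda>\<^sup>+\<close> classes. Suppose that no proper subalgebra of \<open>J\<close> has \<open>\<kappa>\<close> elements.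

  Coarse congruences then have at most \<open>\<lambda>\<close> classes. As \<open>cf \<kappa> > 2 ^ \<lambda>\<^sup>+\<close>, some class has \<open>\<kappa>\<close> elements;
  the union of all classes that meet the subalgebra generated by one element of that class is a
  subalgebra with \<open>\<kappa>\<close> elements, hence everything, so every class meets a subalgebra with at most \<open>\<lambda>\<close>
  elements (\<open>few_classes_if_no_large_subuniverse\<close>).

  On the other hand, any two distinct elements are separated by a coarse congruence, namely by any
  congruence that is maximal among those separating them (\<open>max_omitting_few_classes\<close>). Pick
  \<open>\<lambda>\<^sup>+\<close> elements of \<open>J\<close> and a coarse congruence for each pair of them. The intersection of these \<open>\<lambda>\<^sup>+\<close>
  congruences is again coarse, since \<open>(2 ^ \<lambda>\<^sup>+) ^ \<lambda>\<^sup>+ = 2 ^ \<lambda>\<^sup>+\<close>; so it has at most \<open>\<lambda>\<close> classes. But it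
  separates the \<open>\<lambda>\<^sup>+\<close> elements chosen, a contradiction.

  That maximal separating congruences are coarse is a form of a theorem of Taylor on residually small
  varieties. If \<open>\<theta>\<close> is maximal among the congruences of \<open>A\<close> that omit \<open>(c, d)\<close>, then for any \<open>x\<close>, \<open>y\<close>
  that are not congruent the pair \<open>(c, d)\<close> can be derived from \<open>(x, y)\<close> modulo \<open>\<theta>\<close>. There are only \<open>\<lambda>\<close>
  shapes of derivations. If there were more than \<open>2 ^ \<lambda>\<^sup>+\<close> classes, a partition theorem in the style
  of Erdos and Rado (\<open>weak_Erdos_Rado\<close>) would give an infinite sequence in which one and the same
  shape \<open>p\<close> works for all pairs \<open>s i\<close>, \<open>s j\<close> with \<open>i < j\<close>. In a reduced power of \<open>A\<close> this sequence is
  stretched to an arbitrarily long chain of elements in which \<open>p\<close> still derives \<open>(c, d)\<close> from every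
  pair. A congruence maximal among those omitting \<open>(c, d)\<close> separates the whole chain, so the
  variety contains subdirectly irreducible algebras beyond any bound
  (\<open>derives_eventually\<close>, \<open>bounds_si_max_omitting\<close>).\<close>


section \<open>Cardinal arithmetic\<close>

lemma card_of_lists_ordLeq:
  assumes r: "Cinfinite r" and A: "|A| \<le>o r"
  shows "|lists A| \<le>o r"
proof -
  define L where "L n = {xs \<in> lists A. length xs = n}" for n
  have "|L n| \<le>o r" for n
  proof (induction n)
    case 0
    have "L 0 = {[]}"
      by (auto simp: L_def)
    moreover have "Field r \<noteq> {}"
      using r by (auto simp: cinfinite_def)
    ultimately show ?case
      using r Card_order_singl_ordLeq[of r "[]"] by simp
  next
    case (Suc n)
    have "L (Suc n) \<subseteq> (\<lambda>(x, xs). x # xs) ` (A \<times> L n)"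
      by (auto simp: L_def length_Suc_conv image_iff)
    then have "|L (Suc n)| \<le>o |A \<times> L n|"
      by (rule surj_imp_ordLeq)
    also have "|A \<times> L n| \<le>o r"
      using cprod_cinfinite_bound[OF A Suc card_of_Card_order card_of_Card_order r]
      by (simp add: cprod_def Field_card_of)
    finally show ?case .
  qed
  moreover have "|UNIV :: nat set| \<le>o r"
    using r natLeq_ordLeq_cinfinite card_of_nat ordIso_ordLeq_trans by blast
  ultimately have "|\<Union>n. L n| \<le>o r"
    using UNION_Cinfinite_bound r by blast
  moreover have "(\<Union>n. L n) = lists A"
    by (auto simp: L_def)
  ultimately show ?thesis
    by simp
qed

text \<open>The closure of a small set under few finitary operations is small. The operations are total on
  lists; a partial or fixed-arity operation is used by giving it a default value elsewhere. The set
  \<open>A\<close> is any closed superset that the closure is to stay in.\<close>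

lemma small_closure:
  fixes g :: "'o \<Rightarrow> 'a list \<Rightarrow> 'a"
  assumes r: "Cinfinite r" and X: "|X| \<le>o r" and I: "|I| \<le>o r" and "X \<subseteq> A"
    and closed: "\<And>i xs. i \<in> I \<Longrightarrow> set xs \<subseteq> A \<Longrightarrow> g i xs \<in> A"
  obtains Y where "X \<subseteq> Y" "Y \<subseteq> A" "|Y| \<le>o r"
    "\<And>i xs. i \<in> I \<Longrightarrow> set xs \<subseteq> Y \<Longrightarrow> g i xs \<in> Y"
proof -
  define step where "step C = C \<union> (\<lambda>(i, xs). g i xs) ` (I \<times> lists C)" for C
  define C where "C n = (step ^^ n) X" for n
  have C_Suc: "C (Suc n) = step (C n)" for n
    by (simp add: C_def)
  have size: "|C n| \<le>o r" for n
  proof (induction n)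
    case 0
    then show ?case
      using X by (simp add: C_def)
  next
    case (Suc n)
    have "|I \<times> lists (C n)| \<le>o r"
      using cprod_cinfinite_bound[OF I card_of_lists_ordLeq[OF r Suc] card_of_Card_order
          card_of_Card_order r]
      by (simp add: cprod_def Field_card_of)
    then have "|(\<lambda>(i, xs). g i xs) ` (I \<times> lists (C n))| \<le>o r"
      using card_of_image ordLeq_transitive by blast
    with Suc r show ?case
      unfolding C_Suc step_def by (intro Un_Cinfinite_bound)
  qed
  have sub: "C n \<subseteq> A" for n
  proof (induction n)
    case 0
    then show ?case
      using \<open>X \<subseteq> A\<close> by (simp add: C_def)
  next
    case (Suc n)
    then show ?case
      using closed by (fastforce simp: C_Suc step_def)
  qed
  have "mono C"
    by (rule mono_iff_le_Suc[THEN iffD2]) (auto simp: C_Suc step_def)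
  show ?thesis
  proof
    show "X \<subseteq> (\<Union>n. C n)"
      using C_def[of 0] by auto
    show "(\<Union>n. C n) \<subseteq> A"
      using sub by blast
    have "|UNIV :: nat set| \<le>o r"
      using r natLeq_ordLeq_cinfinite card_of_nat ordIso_ordLeq_trans by blast
    then show "|\<Union>n. C n| \<le>o r"
      using UNION_Cinfinite_bound r size by blast
    show "g i xs \<in> (\<Union>n. C n)" if i: "i \<in> I" and xs: "set xs \<subseteq> (\<Union>n. C n)" for i xs
    proof -
      have "\<exists>n. set xs \<subseteq> C n"
        using xs
      proof (induction xs)
        case (Cons x xs)
        then obtain m n where "set xs \<subseteq> C m" "x \<in> C n"
          by auto
        then have "set (x # xs) \<subseteq> C (max m n)"
          using \<open>mono C\<close>[THEN monoD, of m "max m n"] \<open>mono C\<close>[THEN monoD, of n "max m n"] by auto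
        then show ?case ..
      qed simp
      then obtain n where "xs \<in> lists (C n)"
        by (auto simp: in_lists_conv_set)
      then have "g i xs \<in> C (Suc n)"
        using i by (force simp: C_Suc step_def)
      then show ?thesis
        by blast
    qed
  qed
qed

text \<open>This is \<open>(2 ^ q) ^ q = 2 ^ q\<close>.\<close>

lemma card_of_Func_ordLeq:
  assumes q: "Cinfinite q" and I: "|I| \<le>o q" "I \<noteq> {}" and B: "|B| \<le>o ctwo ^c q"
  shows "|Func I B| \<le>o ctwo ^c q"
proof -
  have ne: "Cnotzero |I|"
    using I by (auto simp: card_of_ordIso_czero_iff_empty card_of_Card_order)
  have "|Func I B| =o |B| ^c |I|"
    by (simp add: cexp_def Field_card_of card_of_refl)
  also have "|B| ^c |I| \<le>o (ctwo ^c q) ^c |I|"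
    by (rule cexp_mono1[OF B card_of_Card_order])
  also have "(ctwo ^c q) ^c |I| \<le>o ctwo ^c q"
    by (rule ordIso_imp_ordLeq, rule cexp_cprod_ordLeq[OF Card_order_ctwo q ne I(1)])
  finally show ?thesis .
qed

lemma cardSuc_ordLeq_if_not_ordLeq:
  assumes r: "Card_order r" and "\<not> |A| \<le>o r"
  shows "cardSuc r \<le>o |A|"
proof (rule cardSuc_least[OF r card_of_Card_order])
  show "r <o |A|"
    using not_ordLeq_iff_ordLess[OF card_order_on_well_order_on[OF r] card_of_Well_order, of A]
      assms(2) by simp
qed


section \<open>Cofinality\<close>

lemma cofinality_ordLeq:
  assumes "unbounded T r"
  shows "cofinality r \<le>o |T|"
proof -
  let ?S = "{|S| | S. unbounded S r}"
  have "\<exists>q\<in>?S. \<forall>q'\<in>?S. q \<le>o q'"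
    by (rule exists_minim_Card_order) (use assms in \<open>auto simp: card_of_card_order_on Field_card_of\<close>)
  then have "\<exists>S. unbounded S r \<and> (\<forall>T. unbounded T r \<longrightarrow> |S| \<le>o |T| )"
    by blast
  from someI_ex[OF this] show ?thesis
    using assms by (simp add: cofinality_def)
qed

lemma cofinality_ordLeq_self:
  assumes "Card_order r"
  shows "cofinality r \<le>o r"
proof -
  interpret wo_rel r
    using card_order_on_well_order_on[OF assms] by (simp add: wo_rel_def)
  have "unbounded (Field r) r"
    using REFL by (auto simp: unbounded_def refl_on_def)
  then show ?thesis
    using cofinality_ordLeq card_of_Field_ordIso[OF assms] ordLeq_ordIso_trans by blast
qed

text \<open>Each \<open>C i\<close> fits into a proper initial segment of \<open>r\<close>. There are fewer than \<open>cf r\<close> of these, so a single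
  initial segment bounds the sizes of all of them; this also covers singular \<open>r\<close>.\<close>

lemma card_of_UNION_ordLess_cofinality:
  assumes r: "Card_order r" and q: "Cinfinite q" "q <o cofinality r"
    and K: "|K| \<le>o q" and C: "\<And>i. i \<in> K \<Longrightarrow> |C i| <o r"
  shows "|\<Union>i\<in>K. C i| <o r"
proof -
  have wo: "Well_order r"
    using card_order_on_well_order_on[OF r] .
  interpret wo_rel r
    using wo by (simp add: wo_rel_def)
  have "\<exists>a\<in>Field r. |C i| \<le>o |Order_Relation.underS r a|" if i: "i \<in> K" for i
  proof -
    obtain a where a: "a \<in> Field r" "|C i| =o Restr r (Order_Relation.underS r a)"
      using C[OF i] ordLess_iff_ordIso_Restr[OF wo card_of_Well_order] by blast
    have "|C i| =o |Field (Restr r (Order_Relation.underS r a))|"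
      using card_of_cong[OF a(2)] by (simp add: Field_card_of)
    also have "|Field (Restr r (Order_Relation.underS r a))| \<le>o |Order_Relation.underS r a|"
      by (rule card_of_mono1) (auto simp: Field_def)
    finally show ?thesis
      using a(1) by blast
  qed
  then obtain a where a: "\<And>i. i \<in> K \<Longrightarrow> a i \<in> Field r"
    "\<And>i. i \<in> K \<Longrightarrow> |C i| \<le>o |Order_Relation.underS r (a i)|"
    by metis
  have "\<not> unbounded (a ` K) r"
  proof
    assume "unbounded (a ` K) r"
    then have "cofinality r \<le>o q"
      by (rule ordLeq_transitive[OF cofinality_ordLeq ordLeq_transitive[OF card_of_image K]])
    with q(2) show False
      using not_ordLess_ordLeq by blast
  qed
  then obtain m where m: "m \<in> Field r" "\<And>i. i \<in> K \<Longrightarrow> (m, a i) \<notin> r"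
    using a(1) by (auto simp: unbounded_def)
  let ?U = "Order_Relation.underS r m"
  have "Order_Relation.underS r (a i) \<subseteq> ?U" if i: "i \<in> K" for i
  proof -
    have "(a i, m) \<in> r"
      using TOTALS m(1) m(2)[OF i] a(1)[OF i] by blast
    then show ?thesis
      using TRANS ANTISYM unfolding Order_Relation.underS_def by (auto dest: transD antisymD)
  qed
  then have CU: "|C i| \<le>o |?U|" if "i \<in> K" for i
    using ordLeq_transitive[OF a(2)[OF that] card_of_mono1] that by blast
  have qr: "q <o r"
    by (rule ordLess_ordLeq_trans[OF q(2) cofinality_ordLeq_self[OF r]])
  have Fq: "|Field q| =o q" "infinite (Field q)"
    using q(1) card_of_Field_ordIso by (auto simp: cinfinite_def)
  have inf: "infinite (Field r)"
    using cinfinite_mono[OF ordLess_imp_ordLeq[OF qr]] q(1) by (simp add: cinfinite_def)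
  \<comment> \<open>The summand \<open>Field q\<close> makes the bound infinite and at least as large as the index set.\<close>
  let ?B = "?U <+> Field q"
  have "|\<Union>i\<in>K. C i| \<le>o |?B|"
  proof (rule card_of_UNION_ordLeq_infinite)
    show "infinite ?B"
      using Fq(2) by simp
    show "|K| \<le>o |?B|"
      by (rule ordLeq_transitive[OF ordLeq_ordIso_trans[OF K ordIso_symmetric[OF Fq(1)]] card_of_Plus2])
    show "\<forall>i\<in>K. |C i| \<le>o |?B|"
      using ordLeq_transitive[OF CU card_of_Plus1] by blast
  qed
  also have "|?B| <o r"
    by (rule card_of_Plus_ordLess_infinite_Field[OF inf r card_of_underS[OF r m(1)]
        ordIso_ordLess_trans[OF Fq(1) qr]])
  finally show ?thesis .
qed


section \<open>A partition theorem\<close>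

lemma increasing_sequence_in_infinite_set:
  assumes wo: "Well_order r" and S: "S \<subseteq> Field r" "infinite S"
  obtains s :: "nat \<Rightarrow> 'a" where "range s \<subseteq> S" "\<And>i j. i < j \<Longrightarrow> s i \<in> underS r (s j)"
proof -
  interpret wo: wo_rel r
    using wo by (simp add: wo_rel_def)
  define T where "T n = ((\<lambda>X. X - {wo.minim X}) ^^ n) S" for n
  have T_Suc: "T (Suc n) = T n - {wo.minim (T n)}" for n
    by (simp add: T_def)
  have T: "T n \<subseteq> S" "infinite (T n)" for n
    using S(2) by (induction n) (auto simp: T_Suc T_def)
  have in_T: "wo.minim (T n) \<in> T n" for n
    using T[of n] S(1) by (intro wo.minim_in) auto
  have "antimono T"
    by (rule antimono_iff_le_Suc[THEN iffD2]) (auto simp: T_Suc)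
  show ?thesis
  proof
    show "range (\<lambda>n. wo.minim (T n)) \<subseteq> S"
      using in_T T by blast
    show "wo.minim (T i) \<in> underS r (wo.minim (T j))" if "i < j" for i j
    proof -
      have "wo.minim (T j) \<in> T (Suc i)"
        using in_T[of j] \<open>antimono T\<close>[THEN antimonoD, of "Suc i" j] that by auto
      then have "wo.minim (T j) \<in> T i" "wo.minim (T j) \<noteq> wo.minim (T i)"
        by (auto simp: T_Suc)
      moreover have "(wo.minim (T i), wo.minim (T j)) \<in> r"
        using T[of i] S(1) \<open>wo.minim (T j) \<in> T i\<close> by (intro wo.minim_least) auto
      ultimately show ?thesis
        by (auto simp: underS_def)
    qed
  qed
qed

lemma infinite_fibre:
  assumes r: "Cinfinite r" and I: "\<not> |I| \<le>o r" and K: "|K| \<le>o r" and f: "f ` I \<subseteq> K"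
  obtains k where "k \<in> K" "infinite {i \<in> I. f i = k}"
proof (rule ccontr)
  note found = that
  assume none: "\<not> thesis"
  have fin: "finite {i \<in> I. f i = k}" if "k \<in> K" for k
    using none found that by blast
  have "|\<Union>k\<in>K. {i \<in> I. f i = k}| \<le>o r"
  proof (rule UNION_Cinfinite_bound[OF K _ r], rule ballI)
    fix k assume "k \<in> K"
    from fin[OF this] have "|{i \<in> I. f i = k}| <o r"
      using r Cfinite_ordLess_Cinfinite[of "|{i \<in> I. f i = k}|" r]
      by (simp add: cfinite_def Field_card_of card_of_card_order_on)
    then show "|{i \<in> I. f i = k}| \<le>o r"
      by (rule ordLess_imp_ordLeq)
  qed
  moreover have "(\<Union>k\<in>K. {i \<in> I. f i = k}) = I"
    using f by auto
  ultimately show False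
    using I by simp
qed

text \<open>A weak form of the theorem of Erdos and Rado that \<open>(2 ^ r)\<^sup>+\<close> points whose pairs are
  coloured in \<open>r\<close> colours have a homogeneous set of size \<open>r\<^sup>+\<close>; from \<open>2 ^ r\<^sup>+\<close> upwards the following simple proof is
  available. Every \<open>a \<in> R\<close> defines a transfinite sequence \<open>X a\<close>: its next term is the least new point
  that is coloured with all earlier terms in the same way as \<open>a\<close> is. Once \<open>X a\<close> reaches \<open>a\<close>, the
  colours met on the way determine \<open>a\<close>. There are only \<open>2 ^ r\<^sup>+\<close> colour sequences of length at most
  \<open>r\<^sup>+\<close>, so some \<open>X a\<close> runs through \<open>r\<^sup>+\<close> without reaching \<open>a\<close>. In it the colour of a pair depends only
  on the earlier point, and infinitely many points share that colour.\<close>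

lemma weak_Erdos_Rado:
  fixes r :: "'b rel" and R :: "'a set" and col :: "'a \<Rightarrow> 'a \<Rightarrow> 'k"
  assumes r: "Cinfinite r" and K: "|K| \<le>o r"
    and col: "\<And>x y. x \<in> R \<Longrightarrow> y \<in> R \<Longrightarrow> x \<noteq> y \<Longrightarrow> col x y \<in> K"
    and big: "\<not> |R| \<le>o ctwo ^c cardSuc r"
  obtains k and s :: "nat \<Rightarrow> 'a" where "range s \<subseteq> R"
    "\<And>i j. i < j \<Longrightarrow> s i \<noteq> s j \<and> col (s i) (s j) = k"
proof -
  define L where "L = cardSuc r"
  have L: "Cinfinite L" "Well_order L"
    using r Cinfinite_cardSuc cardSuc_Well_order unfolding L_def by blast+
  interpret L: wo_rel L
    using L by (simp add: wo_rel_def)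
  interpret R: wo_rel "|R|"
    by (simp add: wo_rel_def card_of_Well_order)
  define candidates where "candidates a f \<alpha> =
    {x \<in> R. \<forall>\<beta>\<in>underS L \<alpha>. x \<noteq> f \<beta> \<and> col (f \<beta>) x = col (f \<beta>) a}" for a f \<alpha>
  define H where "H a f \<alpha> = R.minim (candidates a f \<alpha>)" for a f \<alpha>
  define X where "X a = L.worec (H a)" for a
  have X: "X a \<alpha> = R.minim (candidates a (X a) \<alpha>)" for a \<alpha>
  proof -
    have "candidates a f x = candidates a g x" if "\<forall>y\<in>underS L x. f y = g y" for f g x
      using that unfolding candidates_def by (intro Collect_cong) auto
    then have "L.adm_wo (H a)"
      unfolding L.adm_wo_def H_def by metis
    then have "X a = H a (X a)"
      unfolding X_def by (rule L.worec_fixpoint)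
    then show ?thesis
      unfolding H_def by metis
  qed
  have X_in: "X a \<alpha> \<in> candidates a (X a) \<alpha>"
    if "a \<in> R" and "\<forall>\<beta>\<in>underS L \<alpha>. X a \<beta> \<noteq> a" for a \<alpha>
  proof -
    have "a \<in> candidates a (X a) \<alpha>"
      using that unfolding candidates_def by auto
    then show ?thesis
      unfolding X[of a \<alpha>] by (intro R.minim_in) (auto simp: candidates_def Field_card_of)
  qed
  have "\<exists>a\<in>R. \<forall>\<alpha>\<in>Field L. X a \<alpha> \<noteq> a"
  proof (rule ccontr)
    assume "\<not> ?thesis"
    then have hits: "\<exists>\<alpha>\<in>Field L. X a \<alpha> = a" if "a \<in> R" for a
      using that by blast
    \<comment> \<open>The colours along \<open>X a\<close>, with \<open>None\<close> from the first \<open>\<beta>\<close> on where \<open>X a \<beta> = a\<close>.\<close>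
    define code where "code a = (\<lambda>\<beta>. if \<beta> \<in> Field L
      then if \<forall>\<gamma>\<in>under L \<beta>. X a \<gamma> \<noteq> a then Some (col (X a \<beta>) a) else None
      else undefined)" for a
    have under: "under L \<beta> = insert \<beta> (underS L \<beta>)" if "\<beta> \<in> Field L" for \<beta>
      using that L.REFL by (auto simp: under_def underS_def refl_on_def)
    have "inj_on code R"
    proof (rule inj_onI)
      fix a b assume a: "a \<in> R" and b: "b \<in> R" and eq: "code a = code b"
      have agree: "X a \<alpha> = X b \<alpha>" if "\<alpha> \<in> Field L" "\<forall>\<beta>\<in>underS L \<alpha>. code a \<beta> \<noteq> None" for \<alpha>
        using that
      proof (induction \<alpha> rule: L.well_order_induct)
        case (1 \<alpha>)
        have *: "X a \<beta> = X b \<beta> \<and> col (X b \<beta>) a = col (X b \<beta>) b" if \<beta>: "\<beta> \<in> underS L \<alpha>" for \<beta>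
        proof -
          have "\<beta> \<in> Field L"
            using \<beta> by (auto simp: underS_def Field_def)
          moreover have "underS L \<beta> \<subseteq> underS L \<alpha>"
            using \<beta> L.TRANS L.ANTISYM unfolding underS_def
            by (auto dest: transD antisymD)
          ultimately have "X a \<beta> = X b \<beta>"
            using 1(1)[rule_format, of \<beta>] 1(3) \<beta> by (simp add: underS_def subset_iff)
          moreover have "code a \<beta> \<noteq> None"
            using 1(3) \<beta> by blast
          moreover from this have "code b \<beta> \<noteq> None"
            using eq by simp
          moreover have "code a \<beta> = code b \<beta>"
            using eq by simp
          ultimately show ?thesis
            using \<open>\<beta> \<in> Field L\<close> by (auto simp: code_def split: if_splits)
        qed
        have "candidates a (X a) \<alpha> = candidates b (X b) \<alpha>"
          unfolding candidates_def using * by (intro Collect_cong) auto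
        then show ?case
          using X by metis
      qed
      define Z where "Z = {\<alpha> \<in> Field L. X a \<alpha> = a}"
      have Z: "Z \<subseteq> Field L" "Z \<noteq> {}"
        using hits[OF a] by (auto simp: Z_def)
      define \<alpha> where "\<alpha> = L.minim Z"
      have \<alpha>: "\<alpha> \<in> Field L" "X a \<alpha> = a"
        using L.minim_in[OF Z] by (auto simp: \<alpha>_def Z_def)
      have below: "X a \<beta> \<noteq> a" if "\<beta> \<in> underS L \<alpha>" for \<beta>
      proof
        assume "X a \<beta> = a"
        with that have "\<beta> \<in> Z"
          by (auto simp: Z_def underS_def Field_def)
        then have "(\<alpha>, \<beta>) \<in> L"
          unfolding \<alpha>_def using Z(1) by (rule L.minim_least[rotated])
        with that show False
          using L.ANTISYM by (auto simp: underS_def dest: antisymD)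
      qed
      have some: "code a \<beta> \<noteq> None" if \<beta>: "\<beta> \<in> underS L \<alpha>" for \<beta>
      proof -
        have "\<beta> \<in> Field L" and "under L \<beta> \<subseteq> underS L \<alpha>"
          using \<beta> L.TRANS L.ANTISYM unfolding under_def underS_def Field_def
          by (auto dest: transD antisymD)
        then show ?thesis
          using below by (auto simp: code_def)
      qed
      have "code b \<alpha> = None"
        using \<alpha> under[OF \<alpha>(1)] eq[symmetric] by (auto simp: code_def)
      then obtain \<gamma> where \<gamma>: "\<gamma> \<in> under L \<alpha>" "X b \<gamma> = b"
        using \<alpha> by (auto simp: code_def split: if_splits)
      have "\<gamma> \<notin> underS L \<alpha>"
      proof
        assume g: "\<gamma> \<in> underS L \<alpha>"
        then have "\<gamma> \<in> Field L"
          by (auto simp: underS_def Field_def)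
        with \<gamma> have "code b \<gamma> = None"
          using under[of \<gamma>] by (auto simp: code_def)
        with some[OF g] eq show False
          by simp
      qed
      then have "\<gamma> = \<alpha>"
        using \<gamma>(1) under[OF \<alpha>(1)] by blast
      with agree[OF \<alpha>(1)] some \<gamma>(2) \<alpha>(2) show "a = b"
        by simp
    qed
    moreover have "code a \<in> Func (Field L) (insert None (Some ` K))" if a: "a \<in> R" for a
    proof -
      have "col (X a \<beta>) a \<in> K" if \<beta>: "\<beta> \<in> Field L" "\<forall>\<gamma>\<in>under L \<beta>. X a \<gamma> \<noteq> a" for \<beta>
      proof -
        have "X a \<beta> \<noteq> a" "\<forall>\<gamma>\<in>underS L \<beta>. X a \<gamma> \<noteq> a"
          using \<beta> under[OF \<beta>(1)] by auto
        moreover from this have "X a \<beta> \<in> R"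
          using X_in[OF a] by (auto simp: candidates_def)
        ultimately show ?thesis
          using col a by blast
      qed
      then show ?thesis
        by (auto simp: Func_def code_def)
    qed
    ultimately have "|R| \<le>o |Func (Field L) (insert None (Some ` K))|"
      by (intro card_of_ordLeqI)
    also have "|Func (Field L) (insert None (Some ` K))| \<le>o ctwo ^c L"
    proof (rule card_of_Func_ordLeq[OF L(1)])
      show "|Field L| \<le>o L" "Field L \<noteq> {}"
        using L(1) card_of_Field_ordIso ordIso_imp_ordLeq by (auto simp: cinfinite_def)
      have "|Some ` K| \<le>o r"
        using K card_of_image ordLeq_transitive by blast
      moreover have "|{None :: 'k option}| \<le>o r"
        using r by (intro Card_order_singl_ordLeq) (auto simp: cinfinite_def)
      ultimately have "|{None} \<union> Some ` K| \<le>o r"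
        using r by (intro Un_Cinfinite_bound)
      also have "r \<le>o L"
        using r by (simp add: L_def cardSuc_ordLeq)
      also have "L \<le>o ctwo ^c L"
        using L(1) by (intro ordLess_imp_ordLeq ordLess_ctwo_cexp) auto
      finally show "|insert None (Some ` K)| \<le>o ctwo ^c L"
        by simp
    qed
    finally show False
      using big by (simp add: L_def)
  qed
  then obtain a where a: "a \<in> R" and never: "\<And>\<alpha>. \<alpha> \<in> Field L \<Longrightarrow> X a \<alpha> \<noteq> a"
    by blast
  have cand: "X a \<alpha> \<in> candidates a (X a) \<alpha>" for \<alpha>
    using never by (intro X_in[OF a]) (auto simp: underS_def Field_def)
  \<comment> \<open>Along such an \<open>X a\<close> the colour of \<open>(X a \<beta>, X a \<alpha>)\<close>, for \<open>\<beta> < \<alpha>\<close>, is that of \<open>(X a \<beta>, a)\<close>.\<close>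
  have "\<not> |Field L| \<le>o r"
  proof
    assume "|Field L| \<le>o r"
    then have "L \<le>o r"
      using L(1) card_of_Field_ordIso ordIso_ordLeq_trans ordIso_symmetric by blast
    then show False
      using cardSuc_greater[of r] r not_ordLess_ordLeq unfolding L_def by blast
  qed
  moreover have "(\<lambda>\<alpha>. col (X a \<alpha>) a) ` Field L \<subseteq> K"
    using cand never col a by (auto simp: candidates_def)
  ultimately obtain k where "infinite {\<alpha> \<in> Field L. col (X a \<alpha>) a = k}"
    using infinite_fibre[OF r _ K] by metis
  then obtain t :: "nat \<Rightarrow> 'b set" where t: "range t \<subseteq> {\<alpha> \<in> Field L. col (X a \<alpha>) a = k}"
      "\<And>i j. i < j \<Longrightarrow> t i \<in> underS L (t j)"
    using increasing_sequence_in_infinite_set[OF L(2)] by (metis (no_types, lifting) mem_Collect_eq subsetI)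
  show ?thesis
  proof
    show "range (\<lambda>n. X a (t n)) \<subseteq> R"
      using cand by (auto simp: candidates_def)
    show "X a (t i) \<noteq> X a (t j) \<and> col (X a (t i)) (X a (t j)) = k" if "i < j" for i j
      using cand[of "t j"] t(2)[OF that] t(1) by (auto simp: candidates_def)
  qed
qed


section \<open>Congruences\<close>

definition congruence :: "'f signature \<Rightarrow> ('f, 'a) algebra \<Rightarrow> 'a rel \<Rightarrow> bool" where
  "congruence \<Sigma> A \<theta> \<longleftrightarrow> equiv (carrier A) \<theta> \<and>
     (\<forall>f\<in>syms \<Sigma>. \<forall>xs ys. length xs = arity \<Sigma> f \<longrightarrow> list_all2 (\<lambda>x y. (x, y) \<in> \<theta>) xs ys \<longrightarrow>
        (interp A f xs, interp A f ys) \<in> \<theta>)"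

lemma congruenceI:
  assumes "\<theta> \<subseteq> carrier A \<times> carrier A" "\<And>x. x \<in> carrier A \<Longrightarrow> (x, x) \<in> \<theta>"
    "\<And>x y. (x, y) \<in> \<theta> \<Longrightarrow> (y, x) \<in> \<theta>" "\<And>x y z. (x, y) \<in> \<theta> \<Longrightarrow> (y, z) \<in> \<theta> \<Longrightarrow> (x, z) \<in> \<theta>"
    "\<And>f xs ys. f \<in> syms \<Sigma> \<Longrightarrow> length xs = arity \<Sigma> f \<Longrightarrow> list_all2 (\<lambda>x y. (x, y) \<in> \<theta>) xs ys \<Longrightarrow>
        (interp A f xs, interp A f ys) \<in> \<theta>"
  shows "congruence \<Sigma> A \<theta>"
proof -
  have "equiv (carrier A) \<theta>"
    by (intro equivI refl_onI symI transI) (fact assms(1-4))+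
  with assms(5) show ?thesis
    by (simp add: congruence_def)
qed

lemma congruenceD:
  assumes "congruence \<Sigma> A \<theta>"
  shows "\<theta> \<subseteq> carrier A \<times> carrier A" "\<And>x. x \<in> carrier A \<Longrightarrow> (x, x) \<in> \<theta>"
    "\<And>x y. (x, y) \<in> \<theta> \<Longrightarrow> (y, x) \<in> \<theta>" "\<And>x y z. (x, y) \<in> \<theta> \<Longrightarrow> (y, z) \<in> \<theta> \<Longrightarrow> (x, z) \<in> \<theta>"
    "\<And>f xs ys. f \<in> syms \<Sigma> \<Longrightarrow> length xs = arity \<Sigma> f \<Longrightarrow> list_all2 (\<lambda>x y. (x, y) \<in> \<theta>) xs ys \<Longrightarrow>
        (interp A f xs, interp A f ys) \<in> \<theta>"
proof -
  have eq: "equiv (carrier A) \<theta>"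
    using assms by (simp add: congruence_def)
  from eq show "\<theta> \<subseteq> carrier A \<times> carrier A" "\<And>x. x \<in> carrier A \<Longrightarrow> (x, x) \<in> \<theta>"
    by (auto elim: equivE dest: refl_onD)
  from eq show "\<And>x y. (x, y) \<in> \<theta> \<Longrightarrow> (y, x) \<in> \<theta>"
    by (meson equivE symD)
  from eq show "\<And>x y z. (x, y) \<in> \<theta> \<Longrightarrow> (y, z) \<in> \<theta> \<Longrightarrow> (x, z) \<in> \<theta>"
    by (meson equivE transD)
qed (use assms in \<open>simp add: congruence_def\<close>)

lemma congruence_class_eq_iff:
  assumes "congruence \<Sigma> A \<theta>" "x \<in> carrier A" "y \<in> carrier A"
  shows "\<theta> `` {x} = \<theta> `` {y} \<longleftrightarrow> (x, y) \<in> \<theta>"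
  using assms eq_equiv_class_iff unfolding congruence_def by metis

lemma list_all2_args:
  assumes "list_all2 (\<lambda>x y. (x, y) \<in> \<theta>) xs ys" "\<theta> \<subseteq> A \<times> A"
  shows "set xs \<subseteq> A" "set ys \<subseteq> A"
  using assms by (fastforce simp: list_all2_conv_all_nth in_set_conv_nth)+

lemma congruence_Id_on:
  assumes "is_algebra \<Sigma> A"
  shows "congruence \<Sigma> A (Id_on (carrier A))"
proof (rule congruenceI)
  fix f xs ys assume f: "f \<in> syms \<Sigma>" "length xs = arity \<Sigma> f"
    and l: "list_all2 (\<lambda>x y. (x, y) \<in> Id_on (carrier A)) xs ys"
  have "list_all2 (=) xs ys"
    using l by (rule list_all2_mono) auto
  then have "xs = ys"
    by (simp add: list_all2_eq)
  moreover have "set xs \<subseteq> carrier A"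
    using list_all2_args[OF l] by auto
  ultimately show "(interp A f xs, interp A f ys) \<in> Id_on (carrier A)"
    using assms f by (auto simp: is_algebra_def args_def)
qed auto

lemma congruence_INT:
  assumes "I \<noteq> {}" "\<And>i. i \<in> I \<Longrightarrow> congruence \<Sigma> A (\<theta> i)"
  shows "congruence \<Sigma> A (\<Inter>i\<in>I. \<theta> i)"
proof (rule congruenceI)
  note cong = congruenceD[OF assms(2)]
  show "(\<Inter>i\<in>I. \<theta> i) \<subseteq> carrier A \<times> carrier A"
    using \<open>I \<noteq> {}\<close> cong(1) by fast
  show "(x, x) \<in> (\<Inter>i\<in>I. \<theta> i)" if "x \<in> carrier A" for x
    using cong(2) that by simp
  show "(y, x) \<in> (\<Inter>i\<in>I. \<theta> i)" if "(x, y) \<in> (\<Inter>i\<in>I. \<theta> i)" for x y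
    using cong(3) that by simp
  show "(x, z) \<in> (\<Inter>i\<in>I. \<theta> i)"
    if "(x, y) \<in> (\<Inter>i\<in>I. \<theta> i)" "(y, z) \<in> (\<Inter>i\<in>I. \<theta> i)" for x y z
  proof
    fix i assume i: "i \<in> I"
    show "(x, z) \<in> \<theta> i"
      using cong(4)[OF i, of x y z] that i by simp
  qed
  fix f xs ys assume f: "f \<in> syms \<Sigma>" "length xs = arity \<Sigma> f"
    and l: "list_all2 (\<lambda>x y. (x, y) \<in> (\<Inter>i\<in>I. \<theta> i)) xs ys"
  show "(interp A f xs, interp A f ys) \<in> (\<Inter>i\<in>I. \<theta> i)"
  proof
    fix i assume i: "i \<in> I"
    have "list_all2 (\<lambda>x y. (x, y) \<in> \<theta> i) xs ys"
      using l by (rule list_all2_mono) (use i in auto)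
    then show "(interp A f xs, interp A f ys) \<in> \<theta> i"
      using congruenceD(5)[OF assms(2)[OF i]] f by blast
  qed
qed

lemma congruence_Union_chain:
  assumes "C \<noteq> {}" and chain: "\<And>\<theta> \<psi>. \<theta> \<in> C \<Longrightarrow> \<psi> \<in> C \<Longrightarrow> \<theta> \<subseteq> \<psi> \<or> \<psi> \<subseteq> \<theta>"
    and C: "\<And>\<theta>. \<theta> \<in> C \<Longrightarrow> congruence \<Sigma> A \<theta>"
  shows "congruence \<Sigma> A (\<Union>C)"
proof (rule congruenceI)
  note cong = congruenceD[OF C]
  show "\<Union>C \<subseteq> carrier A \<times> carrier A"
    using cong(1) by (rule Union_least)
  show "(x, x) \<in> \<Union>C" if "x \<in> carrier A" for x
    using \<open>C \<noteq> {}\<close> cong(2) that by fast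
  show "(y, x) \<in> \<Union>C" if "(x, y) \<in> \<Union>C" for x y
    using cong(3) that by fast
  show "(x, z) \<in> \<Union>C" if xy: "(x, y) \<in> \<Union>C" and yz: "(y, z) \<in> \<Union>C" for x y z
  proof -
    obtain \<theta> \<psi> where "\<theta> \<in> C" "\<psi> \<in> C" "(x, y) \<in> \<theta>" "(y, z) \<in> \<psi>"
      using xy yz by blast
    then show ?thesis
      using chain[of \<theta> \<psi>] cong(4)[of \<theta> x y z] cong(4)[of \<psi> x y z] by blast
  qed
  fix f xs ys assume f: "f \<in> syms \<Sigma>" "length xs = arity \<Sigma> f"
    and l: "list_all2 (\<lambda>x y. (x, y) \<in> \<Union>C) xs ys"
  have "\<exists>\<theta>\<in>C. list_all2 (\<lambda>x y. (x, y) \<in> \<theta>) xs ys"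
    using l
  proof (induction rule: list_all2_induct)
    case Nil
    then show ?case
      using \<open>C \<noteq> {}\<close> by auto
  next
    case (Cons x xs y ys)
    then obtain \<theta> \<psi> where *: "\<theta> \<in> C" "(x, y) \<in> \<theta>" "\<psi> \<in> C" "list_all2 (\<lambda>x y. (x, y) \<in> \<psi>) xs ys"
      by blast
    show ?case
      using chain[of \<theta> \<psi>]
    proof
      assume "\<theta> \<subseteq> \<psi>"
      with * show ?thesis
        by auto
    next
      assume "\<psi> \<subseteq> \<theta>"
      then have "list_all2 (\<lambda>x y. (x, y) \<in> \<theta>) xs ys"
        by (intro list_all2_mono[OF *(4)]) auto
      with * show ?thesis
        by auto
    qed (use * in auto)
  qed
  then show "(interp A f xs, interp A f ys) \<in> \<Union>C"
    using cong(5) f by fast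
qed

lemma transversal:
  assumes "congruence \<Sigma> A \<theta>"
  obtains R where "R \<subseteq> carrier A" "|R| =o |carrier A // \<theta>|"
    "\<And>x y. x \<in> R \<Longrightarrow> y \<in> R \<Longrightarrow> (x, y) \<in> \<theta> \<Longrightarrow> x = y"
proof -
  have "carrier A // \<theta> \<subseteq> (\<lambda>x. \<theta> `` {x}) ` carrier A"
    by (auto simp: quotient_def)
  then obtain R where R: "R \<subseteq> carrier A" "inj_on (\<lambda>x. \<theta> `` {x}) R"
      "carrier A // \<theta> = (\<lambda>x. \<theta> `` {x}) ` R"
    unfolding subset_image_inj by (elim exE conjE)
  show thesis
  proof (rule that[OF R(1)])
    show "|R| =o |carrier A // \<theta>|"
      using R(2,3) by (intro card_of_ordIsoI[of "\<lambda>x. \<theta> `` {x}"]) (simp add: bij_betw_def)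
    show "x = y" if "x \<in> R" "y \<in> R" "(x, y) \<in> \<theta>" for x y
      using that R congruence_class_eq_iff[OF assms, of x y] by (auto dest: inj_onD)
  qed
qed

lemma card_of_quotient_ordLeq:
  assumes \<theta>: "congruence \<Sigma> A \<theta>" and X: "X \<subseteq> carrier A"
    and "\<And>x y. x \<in> X \<Longrightarrow> y \<in> X \<Longrightarrow> (x, y) \<in> \<theta> \<Longrightarrow> x = y"
  shows "|X| \<le>o |carrier A // \<theta>|"
proof (rule card_of_ordLeqI)
  show "inj_on (\<lambda>x. \<theta> `` {x}) X"
    using assms congruence_class_eq_iff[OF \<theta>] by (intro inj_onI) (auto simp: subset_iff)
  show "\<theta> `` {x} \<in> carrier A // \<theta>" if "x \<in> X" for x
    using that X by (auto intro: quotientI)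
qed

text \<open>The class of an element modulo the intersection is determined by the family of its classes, so
  \<open>(2 ^ q) ^ q = 2 ^ q\<close> bounds the number of classes.\<close>

lemma card_of_quotient_INT:
  assumes q: "Cinfinite q" and I: "|I| \<le>o q" "I \<noteq> {}"
    and \<theta>: "\<And>i. i \<in> I \<Longrightarrow> congruence \<Sigma> A (\<theta> i)" "\<And>i. i \<in> I \<Longrightarrow> |carrier A // \<theta> i| \<le>o ctwo ^c q"
  shows "|carrier A // (\<Inter>i\<in>I. \<theta> i)| \<le>o ctwo ^c q"
proof -
  let ?M = "Field (ctwo ^c q)"
  have M: "|?M| =o ctwo ^c q"
    by (rule card_of_Field_ordIso[OF Card_order_cexp])
  have "\<exists>g. inj_on g (carrier A // \<theta> i) \<and> g ` (carrier A // \<theta> i) \<subseteq> ?M" if "i \<in> I" for i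
    unfolding card_of_ordLeq by (rule ordLeq_ordIso_trans[OF \<theta>(2)[OF that] ordIso_symmetric[OF M]])
  then obtain g where g: "\<And>i. i \<in> I \<Longrightarrow> inj_on (g i) (carrier A // \<theta> i)"
    "\<And>i. i \<in> I \<Longrightarrow> g i ` (carrier A // \<theta> i) \<subseteq> ?M"
    by metis
  have cong: "congruence \<Sigma> A (\<Inter>i\<in>I. \<theta> i)"
    by (rule congruence_INT[OF I(2) \<theta>(1)])
  obtain R where R: "R \<subseteq> carrier A" "|R| =o |carrier A // (\<Inter>i\<in>I. \<theta> i)|"
    "\<And>x y. x \<in> R \<Longrightarrow> y \<in> R \<Longrightarrow> (x, y) \<in> (\<Inter>i\<in>I. \<theta> i) \<Longrightarrow> x = y"
    by (rule transversal[OF cong]) (rule that)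
  define code where "code x i = (if i \<in> I then g i (\<theta> i `` {x}) else undefined)" for x i
  have "|R| \<le>o |Func I ?M|"
  proof (rule card_of_ordLeqI)
    show "code x \<in> Func I ?M" if "x \<in> R" for x
      using that R(1) g(2) quotientI[of x "carrier A"] by (fastforce simp: Func_def code_def)
    show "inj_on code R"
    proof (rule inj_onI, rule R(3))
      fix x y assume xy: "x \<in> R" "y \<in> R" and eq: "code x = code y"
      show "(x, y) \<in> (\<Inter>i\<in>I. \<theta> i)"
      proof
        fix i assume i: "i \<in> I"
        have x: "x \<in> carrier A" and y: "y \<in> carrier A"
          using xy R(1) by auto
        have "g i (\<theta> i `` {x}) = g i (\<theta> i `` {y})"
          using fun_cong[OF eq, of i] i by (simp add: code_def)
        then have "\<theta> i `` {x} = \<theta> i `` {y}"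
          using inj_onD[OF g(1)[OF i]] quotientI[OF x] quotientI[OF y] by metis
        then show "(x, y) \<in> \<theta> i"
          using congruence_class_eq_iff[OF \<theta>(1)[OF i] x y] by simp
      qed
    qed
  qed
  also have "|Func I ?M| \<le>o ctwo ^c q"
    by (rule card_of_Func_ordLeq[OF q I ordIso_imp_ordLeq[OF M]])
  finally show ?thesis
    by (rule ordIso_ordLeq_trans[OF ordIso_symmetric[OF R(2)]])
qed

text \<open>Such a \<open>\<theta>\<close> is one for which \<open>A / \<theta>\<close> is subdirectly irreducible with \<open>(c, d)\<close> in its least nontrivial
  congruence. Speaking of \<open>\<theta>\<close> on \<open>A\<close> itself makes it unnecessary to form the quotient.\<close>

definition max_omitting :: "'f signature \<Rightarrow> ('f, 'a) algebra \<Rightarrow> 'a \<Rightarrow> 'a \<Rightarrow> 'a rel \<Rightarrow> bool" where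
  "max_omitting \<Sigma> A c d \<theta> \<longleftrightarrow> congruence \<Sigma> A \<theta> \<and> c \<in> carrier A \<and> d \<in> carrier A \<and> (c, d) \<notin> \<theta> \<and>
     (\<forall>\<psi>. congruence \<Sigma> A \<psi> \<and> \<theta> \<subseteq> \<psi> \<and> (c, d) \<notin> \<psi> \<longrightarrow> \<psi> = \<theta>)"

lemma max_omitting_exists:
  assumes \<theta>: "congruence \<Sigma> A \<theta>" "(c, d) \<notin> \<theta>" and cd: "c \<in> carrier A" "d \<in> carrier A"
  obtains \<psi> where "\<theta> \<subseteq> \<psi>" "max_omitting \<Sigma> A c d \<psi>"
proof -
  let ?S = "{\<psi>. congruence \<Sigma> A \<psi> \<and> \<theta> \<subseteq> \<psi> \<and> (c, d) \<notin> \<psi>}"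
  have "\<exists>M\<in>?S. \<forall>X\<in>?S. M \<subseteq> X \<longrightarrow> X = M"
  proof (rule subset_Zorn_nonempty)
    show "?S \<noteq> {}"
      using \<theta> by blast
    fix C assume C: "C \<noteq> {}" "subset.chain ?S C"
    then have "congruence \<Sigma> A (\<Union>C)"
      by (intro congruence_Union_chain) (auto simp: subset_chain_def)
    with C show "\<Union>C \<in> ?S"
      by (auto simp: subset_chain_def)
  qed
  then obtain \<psi> where "\<psi> \<in> ?S" "\<forall>X\<in>?S. \<psi> \<subseteq> X \<longrightarrow> X = \<psi>" ..
  then show thesis
    using that[of \<psi>] cd unfolding max_omitting_def by blast
qed


section \<open>Derivations in generated congruences\<close>

text \<open>The shape of a derivation of a pair in the congruence generated by \<open>\<theta>\<close> and one further pair. It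
  records which closure rule is used where but no elements of the algebra: so there are few shapes,
  and one shape can be used with many pairs, in many algebras, and coordinatewise in powers.\<close>

datatype 'f derivation =
  Given | Modulo | Flip "'f derivation" | Join "'f derivation" "'f derivation"
  | Apply 'f "'f derivation list"

inductive derives ::
    "'f signature \<Rightarrow> ('f, 'a) algebra \<Rightarrow> 'a rel \<Rightarrow> 'a \<Rightarrow> 'a \<Rightarrow> 'f derivation \<Rightarrow> 'a \<Rightarrow> 'a \<Rightarrow> bool"
  for \<Sigma> A \<theta> x y
where
  Given: "derives \<Sigma> A \<theta> x y Given x y"
| Modulo: "(u, v) \<in> \<theta> \<Longrightarrow> derives \<Sigma> A \<theta> x y Modulo u v"
| Flip: "derives \<Sigma> A \<theta> x y p u v \<Longrightarrow> derives \<Sigma> A \<theta> x y (Flip p) v u"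
| Join: "derives \<Sigma> A \<theta> x y p u v \<Longrightarrow> derives \<Sigma> A \<theta> x y q v w \<Longrightarrow> derives \<Sigma> A \<theta> x y (Join p q) u w"
| Apply: "f \<in> syms \<Sigma> \<Longrightarrow> length us = arity \<Sigma> f \<Longrightarrow> length vs = length us \<Longrightarrow> length ps = length us \<Longrightarrow>
    (\<And>i. i < length us \<Longrightarrow> derives \<Sigma> A \<theta> x y (ps ! i) (us ! i) (vs ! i)) \<Longrightarrow>
    derives \<Sigma> A \<theta> x y (Apply f ps) (interp A f us) (interp A f vs)"

inductive_cases derives_elims:
  "derives \<Sigma> A \<theta> x y Given u v" "derives \<Sigma> A \<theta> x y Modulo u v" "derives \<Sigma> A \<theta> x y (Flip p) u v"
  "derives \<Sigma> A \<theta> x y (Join p q) u v"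

lemma derives_in_congruence:
  assumes "derives \<Sigma> A \<theta> x y p u v" "congruence \<Sigma> A \<psi>" "\<theta> \<subseteq> \<psi>" "(x, y) \<in> \<psi>"
  shows "(u, v) \<in> \<psi>"
  using assms(1)
proof induction
  case (Apply f us vs ps)
  then have "list_all2 (\<lambda>x y. (x, y) \<in> \<psi>) us vs"
    by (simp add: list_all2_conv_all_nth)
  then show ?case
    using congruenceD(5)[OF assms(2)] Apply by blast
qed (use assms congruenceD(3,4)[OF assms(2)] in blast)+

lemma derives_carrier:
  assumes "derives \<Sigma> A \<theta> x y p u v" "is_algebra \<Sigma> A" "\<theta> \<subseteq> carrier A \<times> carrier A"
    "x \<in> carrier A" "y \<in> carrier A"
  shows "u \<in> carrier A \<and> v \<in> carrier A"
  using assms(1)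
proof induction
  case (Apply f us vs ps)
  then have "set us \<subseteq> carrier A" "set vs \<subseteq> carrier A"
    by (auto simp: in_set_conv_nth)
  then show ?case
    using assms(2) Apply by (auto simp: is_algebra_def args_def)
qed (use assms(3-) in auto)

text \<open>Derivability is the congruence generated by \<open>\<theta>\<close> and \<open>(x, y)\<close>: it is a congruence, and
  \<open>derives_in_congruence\<close> says that it is the least one.\<close>

lemma congruence_derivable:
  assumes A: "is_algebra \<Sigma> A" and \<theta>: "congruence \<Sigma> A \<theta>" and xy: "x \<in> carrier A" "y \<in> carrier A"
  shows "congruence \<Sigma> A {(u, v). \<exists>p. derives \<Sigma> A \<theta> x y p u v}"
proof (rule congruenceI)
  show "{(u, v). \<exists>p. derives \<Sigma> A \<theta> x y p u v} \<subseteq> carrier A \<times> carrier A"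
    using derives_carrier[OF _ A congruenceD(1)[OF \<theta>] xy] by auto
  fix f us vs assume f: "f \<in> syms \<Sigma>" "length us = arity \<Sigma> f"
    and l: "list_all2 (\<lambda>u v. (u, v) \<in> {(u, v). \<exists>p. derives \<Sigma> A \<theta> x y p u v}) us vs"
  define ps where "ps = map (\<lambda>i. SOME p. derives \<Sigma> A \<theta> x y p (us ! i) (vs ! i)) [0..<length us]"
  have "derives \<Sigma> A \<theta> x y (Apply f ps) (interp A f us) (interp A f vs)"
  proof (rule derives.Apply[OF f])
    show "length vs = length us"
      using l by (simp add: list_all2_lengthD)
    show "length ps = length us"
      by (simp add: ps_def)
    show "derives \<Sigma> A \<theta> x y (ps ! i) (us ! i) (vs ! i)" if "i < length us" for i
      using l that by (auto simp: ps_def list_all2_conv_all_nth intro: someI_ex)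
  qed
  then show "(interp A f us, interp A f vs) \<in> {(u, v). \<exists>p. derives \<Sigma> A \<theta> x y p u v}"
    by blast
qed (use congruenceD(2)[OF \<theta>] in \<open>blast intro: derives.intros\<close>)+

lemma max_omitting_derives:
  assumes A: "is_algebra \<Sigma> A" and \<theta>: "max_omitting \<Sigma> A c d \<theta>"
    and xy: "x \<in> carrier A" "y \<in> carrier A" "(x, y) \<notin> \<theta>"
  obtains p where "derives \<Sigma> A \<theta> x y p c d"
proof -
  let ?\<psi> = "{(u, v). \<exists>p. derives \<Sigma> A \<theta> x y p u v}"
  have "congruence \<Sigma> A ?\<psi>"
    using congruence_derivable[OF A _ xy(1,2)] \<theta> by (simp add: max_omitting_def)
  moreover have "\<theta> \<subseteq> ?\<psi>" "(x, y) \<in> ?\<psi>"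
    by (blast intro: derives.intros)+
  ultimately have "(c, d) \<in> ?\<psi>"
    using \<theta> xy(3) unfolding max_omitting_def by blast
  then show thesis
    using that by blast
qed

text \<open>Only operation symbols of the signature occur in derivations, while the type \<open>'f\<close> may be much larger
  than \<open>syms \<Sigma>\<close>.\<close>

inductive_set shapes :: "'f signature \<Rightarrow> 'f derivation set" for \<Sigma> where
  "Given \<in> shapes \<Sigma>"
| "Modulo \<in> shapes \<Sigma>"
| "p \<in> shapes \<Sigma> \<Longrightarrow> Flip p \<in> shapes \<Sigma>"
| "p \<in> shapes \<Sigma> \<Longrightarrow> q \<in> shapes \<Sigma> \<Longrightarrow> Join p q \<in> shapes \<Sigma>"
| "f \<in> syms \<Sigma> \<Longrightarrow> (\<And>p. p \<in> set ps \<Longrightarrow> p \<in> shapes \<Sigma>) \<Longrightarrow> Apply f ps \<in> shapes \<Sigma>"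

lemma derives_shapes: "derives \<Sigma> A \<theta> x y p u v \<Longrightarrow> p \<in> shapes \<Sigma>"
proof (induction rule: derives.induct)
  case (Apply f us vs ps)
  then show ?case
    by (auto simp: in_set_conv_nth intro!: shapes.intros)
qed (auto intro: shapes.intros)

lemma Cinfinite_lang_card: "Cinfinite (lang_card \<Sigma>)"
  unfolding lang_card_def using Cinfinite_csum1 natLeq_Cinfinite Card_order_csum by blast

lemma card_of_nat_Plus_syms: "|(UNIV :: nat set) <+> syms \<Sigma>| =o lang_card \<Sigma>"
  unfolding lang_card_def
  using ordIso_transitive[OF Plus_csum csum_cong1[OF card_of_nat]] .

text \<open>The constructors are finitary operations, indexed by the numbers \<open>0\<close> and \<open>1\<close> and the operation
  symbols, and the two constants generate all shapes.\<close>

lemma card_of_shapes: "|shapes \<Sigma>| \<le>o lang_card \<Sigma>"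
proof -
  \<comment> \<open>All indices other than \<open>0\<close> act like \<open>1\<close>, and \<open>Given\<close> is the value on lists of the wrong length.\<close>
  let ?g = "\<lambda>i ps. case i of Inl n \<Rightarrow>
      (if (n :: nat) = 0 then (case ps of [p] \<Rightarrow> Flip p | _ \<Rightarrow> Given)
       else (case ps of [p, q] \<Rightarrow> Join p q | _ \<Rightarrow> Given))
    | Inr f \<Rightarrow> Apply f ps"
  have "|{Given, Modulo :: 'f derivation}| \<le>o lang_card \<Sigma>"
    by (rule ordLess_imp_ordLeq, rule Cfinite_ordLess_Cinfinite[OF _ Cinfinite_lang_card])
      (simp add: cfinite_def Field_card_of card_of_card_order_on)
  moreover have "|(UNIV :: nat set) <+> syms \<Sigma>| \<le>o lang_card \<Sigma>"
    using card_of_nat_Plus_syms ordIso_imp_ordLeq by blast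
  ultimately obtain Y where Y: "{Given, Modulo} \<subseteq> Y" "|Y| \<le>o lang_card \<Sigma>"
    "\<And>i ps. i \<in> UNIV <+> syms \<Sigma> \<Longrightarrow> set ps \<subseteq> Y \<Longrightarrow> ?g i ps \<in> Y"
    using small_closure[OF Cinfinite_lang_card[of \<Sigma>], of "{Given, Modulo}" "UNIV <+> syms \<Sigma>" UNIV ?g]
    by (metis UNIV_I subset_UNIV)
  have "p \<in> Y" if "p \<in> shapes \<Sigma>" for p
    using that
  proof induction
    case (3 p)
    then show ?case
      using Y(3)[of "Inl 0" "[p]"] by auto
  next
    case (4 p q)
    then show ?case
      using Y(3)[of "Inl 1" "[p, q]"] by auto
  next
    case (5 f ps)
    then show ?case
      using Y(3)[of "Inr f" ps] by auto
  qed (use Y(1) in auto)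
  then have "|shapes \<Sigma>| \<le>o |Y|"
    by (intro card_of_mono1 subsetI)
  then show ?thesis
    using Y(2) by (rule ordLeq_transitive)
qed


section \<open>Small subalgebras\<close>

definition subuniverse :: "'f signature \<Rightarrow> ('f, 'a) algebra \<Rightarrow> 'a set \<Rightarrow> bool" where
  "subuniverse \<Sigma> A Y \<longleftrightarrow> Y \<subseteq> carrier A \<and> (\<forall>f\<in>syms \<Sigma>. \<forall>xs\<in>args \<Sigma> f Y. interp A f xs \<in> Y)"

lemma small_subuniverse:
  fixes \<Sigma> :: "'f signature" and A :: "('f, 'a) algebra"
  assumes A: "is_algebra \<Sigma> A" and c: "c \<in> carrier A"
  obtains G where "subuniverse \<Sigma> A G" "c \<in> G" "|G| \<le>o lang_card \<Sigma>"
proof -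
  \<comment> \<open>The indices \<open>Inl n\<close> only serve to use the known cardinality of the index set.\<close>
  define g where "g i xs = (case i of Inl n \<Rightarrow> c
    | Inr f \<Rightarrow> if length xs = arity \<Sigma> f then interp A f xs else c)" for i :: "nat + 'f" and xs
  have "|{c}| \<le>o lang_card \<Sigma>"
    using Cinfinite_lang_card[of \<Sigma>] by (intro Card_order_singl_ordLeq) (auto simp: cinfinite_def)
  moreover have "g i xs \<in> carrier A" if "i \<in> UNIV <+> syms \<Sigma>" "set xs \<subseteq> carrier A" for i xs
    using that A c by (auto simp: g_def is_algebra_def args_def)
  ultimately obtain G where G: "{c} \<subseteq> G" "G \<subseteq> carrier A" "|G| \<le>o lang_card \<Sigma>"
    and closed: "\<And>i xs. i \<in> UNIV <+> syms \<Sigma> \<Longrightarrow> set xs \<subseteq> G \<Longrightarrow> g i xs \<in> G"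
    using small_closure[OF Cinfinite_lang_card _ ordIso_imp_ordLeq[OF card_of_nat_Plus_syms],
        of "{c}" \<Sigma> "carrier A" g] c
    by (metis empty_subsetI insert_subset)
  have "subuniverse \<Sigma> A G"
    unfolding subuniverse_def
  proof (intro conjI ballI G(2))
    fix f xs assume "f \<in> syms \<Sigma>" "xs \<in> args \<Sigma> f G"
    then show "interp A f xs \<in> G"
      using closed[of "Inr f" xs] by (auto simp: g_def args_def)
  qed
  with G that show thesis
    by auto
qed

text \<open>A derivation mentions finitely many elements, and it remains valid in every subalgebra that
  contains them.\<close>

lemma derives_finite_support:
  assumes "is_algebra \<Sigma> A" "\<theta> \<subseteq> carrier A \<times> carrier A" "derives \<Sigma> A \<theta> x y p u v"
  obtains W where "finite W" "W \<subseteq> carrier A"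
    "\<And>Y. x \<in> Y \<Longrightarrow> y \<in> Y \<Longrightarrow> subuniverse \<Sigma> A Y \<Longrightarrow> W \<subseteq> Y \<Longrightarrow>
       derives \<Sigma> (A\<lparr>carrier := Y\<rparr>) (\<theta> \<inter> Y \<times> Y) x y p u v"
proof -
  have "\<exists>W. finite W \<and> W \<subseteq> carrier A \<and>
    (\<forall>Y. x \<in> Y \<and> y \<in> Y \<and> subuniverse \<Sigma> A Y \<and> W \<subseteq> Y \<longrightarrow>
       derives \<Sigma> (A\<lparr>carrier := Y\<rparr>) (\<theta> \<inter> Y \<times> Y) x y p u v)"
    using assms(3)
  proof induction
    case Given
    show ?case
      by (rule exI[of _ "{}"]) (auto intro: derives.Given)
  next
    case (Modulo u v)
    then show ?case
      using assms(2) by (intro exI[of _ "{u, v}"]) (auto intro: derives.Modulo)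
  next
    case (Flip p u v)
    from Flip.IH obtain W where W: "finite W" "W \<subseteq> carrier A"
      "\<And>Y. x \<in> Y \<and> y \<in> Y \<and> subuniverse \<Sigma> A Y \<and> W \<subseteq> Y \<Longrightarrow>
        derives \<Sigma> (A\<lparr>carrier := Y\<rparr>) (\<theta> \<inter> Y \<times> Y) x y p u v"
      by (elim exE conjE) simp
    show ?case
      by (intro exI[of _ W] conjI allI impI derives.Flip, rule W(1), rule W(2), rule W(3))
  next
    case (Join p u v q w)
    from Join.IH(1) obtain W1 where W1: "finite W1" "W1 \<subseteq> carrier A"
      "\<And>Y. x \<in> Y \<and> y \<in> Y \<and> subuniverse \<Sigma> A Y \<and> W1 \<subseteq> Y \<Longrightarrow>
        derives \<Sigma> (A\<lparr>carrier := Y\<rparr>) (\<theta> \<inter> Y \<times> Y) x y p u v"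
      by (elim exE conjE) simp
    from Join.IH(2) obtain W2 where W2: "finite W2" "W2 \<subseteq> carrier A"
      "\<And>Y. x \<in> Y \<and> y \<in> Y \<and> subuniverse \<Sigma> A Y \<and> W2 \<subseteq> Y \<Longrightarrow>
        derives \<Sigma> (A\<lparr>carrier := Y\<rparr>) (\<theta> \<inter> Y \<times> Y) x y q v w"
      by (elim exE conjE) simp
    show ?case
    proof (intro exI[of _ "W1 \<union> W2"] conjI allI impI)
      fix Y assume "x \<in> Y \<and> y \<in> Y \<and> subuniverse \<Sigma> A Y \<and> W1 \<union> W2 \<subseteq> Y"
      then show "derives \<Sigma> (A\<lparr>carrier := Y\<rparr>) (\<theta> \<inter> Y \<times> Y) x y (Join p q) u w"
        by (intro derives.Join[OF W1(3) W2(3)]) auto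
    qed (use W1 W2 in auto)
  next
    case (Apply f us vs ps)
    then obtain W where W: "\<And>i. i < length us \<Longrightarrow> finite (W i)"
      "\<And>i. i < length us \<Longrightarrow> W i \<subseteq> carrier A"
      "\<And>i Y. i < length us \<Longrightarrow> x \<in> Y \<and> y \<in> Y \<and> subuniverse \<Sigma> A Y \<and> W i \<subseteq> Y \<Longrightarrow>
        derives \<Sigma> (A\<lparr>carrier := Y\<rparr>) (\<theta> \<inter> Y \<times> Y) x y (ps ! i) (us ! i) (vs ! i)"
      by metis
    show ?case
    proof (intro exI[of _ "\<Union>i<length us. W i"] conjI allI impI)
      fix Y assume Y: "x \<in> Y \<and> y \<in> Y \<and> subuniverse \<Sigma> A Y \<and> (\<Union>i<length us. W i) \<subseteq> Y"
      have "derives \<Sigma> (A\<lparr>carrier := Y\<rparr>) (\<theta> \<inter> Y \<times> Y) x y (Apply f ps)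
          (interp (A\<lparr>carrier := Y\<rparr>) f us) (interp (A\<lparr>carrier := Y\<rparr>) f vs)"
      proof (rule derives.Apply)
        fix i assume i: "i < length us"
        then have "W i \<subseteq> Y"
          using Y by blast
        with i Y show "derives \<Sigma> (A\<lparr>carrier := Y\<rparr>) (\<theta> \<inter> Y \<times> Y) x y (ps ! i) (us ! i) (vs ! i)"
          by (intro W(3)) auto
      qed (use Apply.hyps in auto)
      then show "derives \<Sigma> (A\<lparr>carrier := Y\<rparr>) (\<theta> \<inter> Y \<times> Y) x y (Apply f ps) (interp A f us) (interp A f vs)"
        by simp
    qed (use W in auto)
  qed
  then show thesis
    by (elim exE conjE) (rule that, auto)
qed

lemma congruence_restrict:
  assumes "congruence \<Sigma> A \<theta>" "subuniverse \<Sigma> A Y"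
  shows "congruence \<Sigma> (A\<lparr>carrier := Y\<rparr>) (\<theta> \<inter> Y \<times> Y)"
proof (rule congruenceI)
  have "Y \<subseteq> carrier A"
    using assms(2) by (simp add: subuniverse_def)
  show "(x, x) \<in> \<theta> \<inter> Y \<times> Y" if "x \<in> carrier (A\<lparr>carrier := Y\<rparr>)" for x
    using that congruenceD(2)[OF assms(1)] \<open>Y \<subseteq> carrier A\<close> by auto
  fix f xs ys assume f: "f \<in> syms \<Sigma>" "length xs = arity \<Sigma> f"
    and l: "list_all2 (\<lambda>x y. (x, y) \<in> \<theta> \<inter> Y \<times> Y) xs ys"
  have "list_all2 (\<lambda>x y. (x, y) \<in> \<theta>) xs ys"
    using l by (rule list_all2_mono) auto
  moreover have "set xs \<subseteq> Y" "set ys \<subseteq> Y"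
    using list_all2_args[OF l] by auto
  moreover have "length ys = arity \<Sigma> f"
    using l f list_all2_lengthD by fastforce
  ultimately show "(interp (A\<lparr>carrier := Y\<rparr>) f xs, interp (A\<lparr>carrier := Y\<rparr>) f ys) \<in> \<theta> \<inter> Y \<times> Y"
    using congruenceD(5)[OF assms(1) f] assms(2) f by (auto simp: subuniverse_def args_def)
next
  fix x y z
  show "(x, y) \<in> \<theta> \<inter> Y \<times> Y \<Longrightarrow> (y, x) \<in> \<theta> \<inter> Y \<times> Y"
    using congruenceD(3)[OF assms(1), of x y] by simp
  show "(x, y) \<in> \<theta> \<inter> Y \<times> Y \<Longrightarrow> (y, z) \<in> \<theta> \<inter> Y \<times> Y \<Longrightarrow> (x, z) \<in> \<theta> \<inter> Y \<times> Y"
    using congruenceD(4)[OF assms(1), of x y z] by simp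
qed auto

text \<open>A Loewenheim-Skolem argument: close \<open>X\<close> under the operations and, for each pair of incongruent
  elements, under the finitely many witnesses of a derivation of \<open>(c, d)\<close> from that pair. Then every
  congruence of the subalgebra that properly extends \<open>\<theta>\<close> still contains \<open>(c, d)\<close>.\<close>

lemma max_omitting_small_subalgebra:
  fixes \<Sigma> :: "'f signature" and A :: "('f, 'a) algebra"
  assumes A: "is_algebra \<Sigma> A" and \<theta>: "max_omitting \<Sigma> A c d \<theta>"
    and X: "X \<subseteq> carrier A" "|X| \<le>o r" and r: "Cinfinite r" "lang_card \<Sigma> \<le>o r"
  obtains Y where "X \<subseteq> Y" "|Y| \<le>o r" "subuniverse \<Sigma> A Y"
    "max_omitting \<Sigma> (A\<lparr>carrier := Y\<rparr>) c d (\<theta> \<inter> Y \<times> Y)"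
proof -
  have cong: "congruence \<Sigma> A \<theta>" and cd: "c \<in> carrier A" "d \<in> carrier A" "(c, d) \<notin> \<theta>"
    using \<theta> by (auto simp: max_omitting_def)
  have "\<exists>ws. x \<in> carrier A \<longrightarrow> y \<in> carrier A \<longrightarrow> (x, y) \<notin> \<theta> \<longrightarrow> set ws \<subseteq> carrier A \<and>
    (\<forall>Y. x \<in> Y \<longrightarrow> y \<in> Y \<longrightarrow> subuniverse \<Sigma> A Y \<longrightarrow> set ws \<subseteq> Y \<longrightarrow>
      (\<exists>p. derives \<Sigma> (A\<lparr>carrier := Y\<rparr>) (\<theta> \<inter> Y \<times> Y) x y p c d))" for x y
  proof (cases "x \<in> carrier A \<and> y \<in> carrier A \<and> (x, y) \<notin> \<theta>")
    case True
    then obtain p where p: "derives \<Sigma> A \<theta> x y p c d"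
      using max_omitting_derives[OF A \<theta>] by blast
    obtain W where W: "finite W" "W \<subseteq> carrier A"
      "\<And>Y. x \<in> Y \<Longrightarrow> y \<in> Y \<Longrightarrow> subuniverse \<Sigma> A Y \<Longrightarrow> W \<subseteq> Y \<Longrightarrow>
       derives \<Sigma> (A\<lparr>carrier := Y\<rparr>) (\<theta> \<inter> Y \<times> Y) x y p c d"
      using derives_finite_support[OF A congruenceD(1)[OF cong] p] by blast
    obtain ws where ws: "set ws = W"
      using finite_list[OF W(1)] by blast
    show ?thesis
      by (intro exI[of _ ws] conjI impI allI exI[of _ p], simp add: ws W(2))
        (rule W(3), simp_all add: ws)
  qed auto
  then obtain ws where ws: "\<And>x y. x \<in> carrier A \<Longrightarrow> y \<in> carrier A \<Longrightarrow> (x, y) \<notin> \<theta> \<Longrightarrow>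
      set (ws x y) \<subseteq> carrier A"
    "\<And>x y Y. x \<in> carrier A \<Longrightarrow> y \<in> carrier A \<Longrightarrow> (x, y) \<notin> \<theta> \<Longrightarrow> x \<in> Y \<Longrightarrow> y \<in> Y \<Longrightarrow>
      subuniverse \<Sigma> A Y \<Longrightarrow> set (ws x y) \<subseteq> Y \<Longrightarrow>
      \<exists>p. derives \<Sigma> (A\<lparr>carrier := Y\<rparr>) (\<theta> \<inter> Y \<times> Y) x y p c d"
    by metis
  \<comment> \<open>The index \<open>Inl n\<close> yields the \<open>n\<close>-th witness of a pair; \<open>c\<close> is the value wherever nothing is required.\<close>
  define g where "g i xs = (case i of
      Inl n \<Rightarrow> (case xs of [x, y] \<Rightarrow> if (x, y) \<notin> \<theta> \<and> n < length (ws x y) then ws x y ! n else c | _ \<Rightarrow> c)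
    | Inr f \<Rightarrow> if length xs = arity \<Sigma> f then interp A f xs else c)" for i :: "nat + 'f" and xs
  have "|{c, d} \<union> X| \<le>o r"
  proof (rule Un_Cinfinite_bound[OF _ X(2) r(1)])
    show "|{c, d}| \<le>o r"
      by (rule ordLess_imp_ordLeq, rule Cfinite_ordLess_Cinfinite[OF _ r(1)])
        (simp add: cfinite_def Field_card_of card_of_card_order_on)
  qed
  moreover have "|(UNIV :: nat set) <+> syms \<Sigma>| \<le>o r"
    using card_of_nat_Plus_syms r(2) ordIso_ordLeq_trans by blast
  moreover have "g i xs \<in> carrier A" if "i \<in> UNIV <+> syms \<Sigma>" "set xs \<subseteq> carrier A" for i xs
  proof (cases i)
    case (Inl n)
    have "g (Inl n) xs = c \<or> (\<exists>x y. xs = [x, y] \<and> (x, y) \<notin> \<theta> \<and> n < length (ws x y) \<and>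
        g (Inl n) xs = ws x y ! n)"
      by (auto simp: g_def split: list.split)
    then consider "g i xs = c"
      | x y where "xs = [x, y]" "(x, y) \<notin> \<theta>" "n < length (ws x y)" "g i xs = ws x y ! n"
      unfolding Inl by blast
    then show ?thesis
    proof cases
      case 2
      with that(2) show ?thesis
        using ws(1)[of x y] nth_mem[of n "ws x y"] by auto
    qed (use cd in simp)
  next
    case (Inr f)
    then show ?thesis
      using that A cd(1) by (auto simp: g_def is_algebra_def args_def)
  qed
  ultimately obtain Y where Y: "{c, d} \<union> X \<subseteq> Y" "Y \<subseteq> carrier A" "|Y| \<le>o r"
    and closed: "\<And>i xs. i \<in> UNIV <+> syms \<Sigma> \<Longrightarrow> set xs \<subseteq> Y \<Longrightarrow> g i xs \<in> Y"
    using small_closure[OF r(1), of "{c, d} \<union> X" "UNIV <+> syms \<Sigma>" "carrier A" g] X(1) cd(1,2)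
    by (metis Un_subset_iff empty_subsetI insert_subset)
  have sub: "subuniverse \<Sigma> A Y"
    unfolding subuniverse_def
  proof (intro conjI ballI)
    fix f xs assume "f \<in> syms \<Sigma>" "xs \<in> args \<Sigma> f Y"
    then show "interp A f xs \<in> Y"
      using closed[of "Inr f" xs] by (auto simp: g_def args_def)
  qed fact
  have "max_omitting \<Sigma> (A\<lparr>carrier := Y\<rparr>) c d (\<theta> \<inter> Y \<times> Y)"
    unfolding max_omitting_def
  proof (intro conjI allI impI)
    show "congruence \<Sigma> (A\<lparr>carrier := Y\<rparr>) (\<theta> \<inter> Y \<times> Y)"
      by (rule congruence_restrict[OF cong sub])
    fix \<psi> assume \<psi>: "congruence \<Sigma> (A\<lparr>carrier := Y\<rparr>) \<psi> \<and> \<theta> \<inter> Y \<times> Y \<subseteq> \<psi> \<and> (c, d) \<notin> \<psi>"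
    have "(x, y) \<in> \<theta>" if xy: "(x, y) \<in> \<psi>" for x y
    proof (rule ccontr)
      assume no: "(x, y) \<notin> \<theta>"
      have Yxy: "x \<in> Y" "y \<in> Y"
        using \<psi> xy congruenceD(1)[of \<Sigma> "A\<lparr>carrier := Y\<rparr>" \<psi>] by auto
      have "ws x y ! n \<in> Y" if "n < length (ws x y)" for n
        using closed[of "Inl n" "[x, y]"] Yxy no that by (auto simp: g_def)
      then have "set (ws x y) \<subseteq> Y"
        by (auto simp: in_set_conv_nth)
      then obtain p where "derives \<Sigma> (A\<lparr>carrier := Y\<rparr>) (\<theta> \<inter> Y \<times> Y) x y p c d"
        using ws(2)[OF _ _ no Yxy sub] Yxy Y(2) by blast
      then have "(c, d) \<in> \<psi>"
        using derives_in_congruence \<psi> xy by metis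
      then show False
        using \<psi> by blast
    qed
    then show "\<psi> = \<theta> \<inter> Y \<times> Y"
      using \<psi> congruenceD(1)[of \<Sigma> "A\<lparr>carrier := Y\<rparr>" \<psi>] by auto
  qed (use cd Y in auto)
  with Y sub that show thesis
    by auto
qed


section \<open>Homomorphic images, subalgebras and powers in varieties\<close>

lemma homD:
  assumes "h \<in> hom \<Sigma> A B"
  shows "x \<in> carrier A \<Longrightarrow> h x \<in> carrier B"
    "f \<in> syms \<Sigma> \<Longrightarrow> length xs = arity \<Sigma> f \<Longrightarrow> set xs \<subseteq> carrier A \<Longrightarrow>
      h (interp A f xs) = interp B f (map h xs)"
  using assms by (auto simp: hom_def args_def)

lemma trm_val_hom:
  assumes "is_algebra \<Sigma> A" "h \<in> hom \<Sigma> A B" "range v \<subseteq> carrier A" "wf_trm \<Sigma> t"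
  shows "trm_val A v t \<in> carrier A \<and> h (trm_val A v t) = trm_val B (h \<circ> v) t"
  using assms(4)
proof (induction t)
  case (App f ts)
  then have "set (map (trm_val A v) ts) \<subseteq> carrier A"
    by auto
  moreover have "map (trm_val B (h \<circ> v)) ts = map h (map (trm_val A v) ts)"
    using App by (auto simp: comp_def)
  moreover have "h (interp A f (map (trm_val A v) ts)) = interp B f (map h (map (trm_val A v) ts))"
    using App.prems calculation(1) by (intro homD(2)[OF assms(2)]) auto
  moreover have "interp A f (map (trm_val A v) ts) \<in> carrier A"
    using App.prems calculation(1) assms(1) by (simp add: is_algebra_def args_def)
  ultimately show ?case
    by (simp only: trm_val.simps)
qed (use assms(3) in auto)

text \<open>Evaluation of a term commutes with a homomorphism as long as the term only contains operation
  symbols of the signature, whence the assumption on \<open>E\<close>.\<close>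

lemma variety_hom_image:
  assumes A: "A \<in> variety \<Sigma> E" and E: "E \<subseteq> identities \<Sigma>"
    and h: "h \<in> hom \<Sigma> A B" "h ` carrier A = carrier B"
  shows "B \<in> variety \<Sigma> E"
proof -
  have algA: "is_algebra \<Sigma> A"
    using A by (simp add: variety_def)
  define k where "k = inv_into (carrier A) h"
  have k: "k u \<in> carrier A" "h (k u) = u" if "u \<in> carrier B" for u
    using that h(2) unfolding k_def by (auto intro: inv_into_into f_inv_into_f)
  have "interp B f us \<in> carrier B" if f: "f \<in> syms \<Sigma>" and us: "us \<in> args \<Sigma> f (carrier B)" for f us
  proof -
    have sub: "set (map k us) \<subseteq> carrier A" and eq: "map h (map k us) = us"
      using us k by (auto simp: args_def subset_iff map_idI)
    have "interp B f us = h (interp A f (map k us))"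
      using homD(2)[OF h(1) f _ sub] us eq by (simp add: args_def)
    moreover have "interp A f (map k us) \<in> carrier A"
      using algA f us sub by (auto simp: is_algebra_def args_def)
    ultimately show ?thesis
      using homD(1)[OF h(1)] by simp
  qed
  moreover have "satisfies B p" if p: "p \<in> E" for p
    unfolding satisfies_def
  proof (intro allI impI)
    fix v :: "nat \<Rightarrow> 'c"
    assume v: "range v \<subseteq> carrier B"
    have rng: "range (k \<circ> v) \<subseteq> carrier A" and eq: "h \<circ> (k \<circ> v) = v"
      using v k by (auto simp: fun_eq_iff)
    have wf: "wf_trm \<Sigma> (fst p)" "wf_trm \<Sigma> (snd p)"
      using p E by (auto simp: identities_def)
    have "trm_val A (k \<circ> v) (fst p) = trm_val A (k \<circ> v) (snd p)"
      using A p rng by (auto simp: variety_def satisfies_def)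
    then show "trm_val B v (fst p) = trm_val B v (snd p)"
      using trm_val_hom[OF algA h(1) rng wf(1)] trm_val_hom[OF algA h(1) rng wf(2)] eq by simp
  qed
  ultimately show ?thesis
    by (simp add: variety_def is_algebra_def)
qed

lemma trm_val_restrict: "trm_val (A\<lparr>carrier := Y\<rparr>) v t = trm_val A v t"
proof (induction t)
  case (App f ts)
  then show ?case
    by (simp cong: map_cong)
qed simp

lemma variety_subuniverse:
  assumes "A \<in> variety \<Sigma> E" "subuniverse \<Sigma> A Y"
  shows "A\<lparr>carrier := Y\<rparr> \<in> variety \<Sigma> E"
  using assms
  by (fastforce simp: variety_def subuniverse_def is_algebra_def satisfies_def trm_val_restrict)

lemma carrier_power: "g \<in> carrier (product_algebra UNIV (\<lambda>_. A)) \<longleftrightarrow> range g \<subseteq> carrier A"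
  by (auto simp: product_algebra_def PiE_UNIV_domain)

lemma interp_power: "interp (product_algebra UNIV (\<lambda>_. A)) f gs i = interp A f (map (\<lambda>g. g i) gs)"
  by (simp add: product_algebra_def)

lemma trm_val_power:
  "trm_val (product_algebra UNIV (\<lambda>_. A)) v t i = trm_val A (\<lambda>n. v n i) t"
proof (induction t)
  case (App f ts)
  then show ?case
    by (simp add: product_algebra_def cong: map_cong)
qed simp

lemma variety_power:
  fixes A :: "('f, 'a) algebra"
  assumes "A \<in> variety \<Sigma> E"
  shows "product_algebra (UNIV :: 'i set) (\<lambda>_. A) \<in> variety \<Sigma> E"
proof -
  let ?P = "product_algebra (UNIV :: 'i set) (\<lambda>_. A)"
  have "interp ?P f xs \<in> carrier ?P" if f: "f \<in> syms \<Sigma>" and xs: "xs \<in> args \<Sigma> f (carrier ?P)" for f xs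
  proof -
    have "interp A f (map (\<lambda>x. x i) xs) \<in> carrier A" for i
    proof -
      have "map (\<lambda>x. x i) xs \<in> args \<Sigma> f (carrier A)"
        using xs by (auto simp: args_def product_algebra_def PiE_UNIV_domain)
      then show ?thesis
        using assms f by (auto simp: variety_def is_algebra_def)
    qed
    then show ?thesis
      by (simp add: product_algebra_def PiE_UNIV_domain)
  qed
  moreover have "satisfies ?P p" if p: "p \<in> E" for p
    unfolding satisfies_def
  proof (intro allI impI ext)
    fix v :: "nat \<Rightarrow> 'i \<Rightarrow> 'a" and i
    assume v: "range v \<subseteq> carrier ?P"
    have "range (\<lambda>n. v n i) \<subseteq> carrier A"
      using v by (auto simp: product_algebra_def PiE_UNIV_domain)
    then have "trm_val A (\<lambda>n. v n i) (fst p) = trm_val A (\<lambda>n. v n i) (snd p)"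
      using assms p by (auto simp: variety_def satisfies_def)
    then show "trm_val ?P v (fst p) i = trm_val ?P v (snd p) i"
      by (simp add: trm_val_power)
  qed
  ultimately show ?thesis
    by (simp add: variety_def is_algebra_def)
qed


section \<open>Subdirectly irreducible quotients\<close>

lemma congruence_kernel:
  assumes A: "is_algebra \<Sigma> A" and g: "g \<in> hom \<Sigma> A B"
  shows "congruence \<Sigma> A {(x, y). x \<in> carrier A \<and> y \<in> carrier A \<and> g x = g y}" (is "congruence _ _ ?\<theta>")
proof (rule congruenceI)
  fix f xs ys assume f: "f \<in> syms \<Sigma>" "length xs = arity \<Sigma> f"
    and l: "list_all2 (\<lambda>x y. (x, y) \<in> ?\<theta>) xs ys"
  have sub: "set xs \<subseteq> carrier A" "set ys \<subseteq> carrier A"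
    using list_all2_args[OF l] by auto
  have len: "length ys = arity \<Sigma> f"
    using f l list_all2_lengthD by fastforce
  have "map g xs = map g ys"
    using l by (auto simp: list_all2_conv_all_nth intro: nth_equalityI)
  then have "g (interp A f xs) = g (interp A f ys)"
    using homD(2)[OF g f sub(1)] homD(2)[OF g f(1) len sub(2)] by simp
  then show "(interp A f xs, interp A f ys) \<in> ?\<theta>"
    using A f sub len by (auto simp: is_algebra_def args_def)
qed auto

text \<open>The quotient \<open>A / \<theta>\<close>, realised on a prescribed type that has room for it.\<close>

lemma quotient_copy:
  fixes \<Sigma> :: "'f signature" and A :: "('f, 'a) algebra"
  assumes A: "is_algebra \<Sigma> A" and \<theta>: "congruence \<Sigma> A \<theta>"
    and small: "|carrier A // \<theta>| \<le>o |UNIV :: 'u set|"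
  obtains B :: "('f, 'u) algebra" and h where "h \<in> hom \<Sigma> A B" "h ` carrier A = carrier B"
    "\<And>x y. x \<in> carrier A \<Longrightarrow> y \<in> carrier A \<Longrightarrow> h x = h y \<longleftrightarrow> (x, y) \<in> \<theta>"
proof -
  obtain \<iota> :: "'a set \<Rightarrow> 'u" where \<iota>: "inj_on \<iota> (carrier A // \<theta>)"
    using small card_of_ordLeq[of "carrier A // \<theta>" "UNIV :: 'u set"] by auto
  define h where "h x = \<iota> (\<theta> `` {x})" for x
  have h: "h x = h y \<longleftrightarrow> (x, y) \<in> \<theta>" if "x \<in> carrier A" "y \<in> carrier A" for x y
    using that congruence_class_eq_iff[OF \<theta>] inj_onD[OF \<iota>] unfolding h_def by (metis quotientI)
  define k where "k = inv_into (carrier A) h"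
  define B where "B = \<lparr>carrier = h ` carrier A, interp = (\<lambda>f us. h (interp A f (map k us)))\<rparr>"
  have "h (interp A f xs) = interp B f (map h xs)"
    if f: "f \<in> syms \<Sigma>" and xs: "xs \<in> args \<Sigma> f (carrier A)" for f xs
  proof -
    have k: "k (h x) \<in> carrier A" "h (k (h x)) = h x" if "x \<in> carrier A" for x
      using that unfolding k_def by (auto intro: inv_into_into f_inv_into_f)
    have "(x, k (h x)) \<in> \<theta>" if "x \<in> carrier A" for x
      using h[OF that k(1)[OF that]] k(2)[OF that] by simp
    then have "list_all2 (\<lambda>x y. (x, y) \<in> \<theta>) xs (map k (map h xs))"
      using xs by (auto simp: args_def list_all2_conv_all_nth subset_iff)
    then have "(interp A f xs, interp A f (map k (map h xs))) \<in> \<theta>"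
      using congruenceD(5)[OF \<theta> f] xs by (auto simp: args_def)
    moreover from this have "interp A f xs \<in> carrier A" "interp A f (map k (map h xs)) \<in> carrier A"
      using congruenceD(1)[OF \<theta>] by auto
    ultimately show ?thesis
      using h by (simp add: B_def)
  qed
  then have "h \<in> hom \<Sigma> A B"
    by (auto simp: hom_def B_def)
  moreover have "h ` carrier A = carrier B"
    by (simp add: B_def)
  ultimately show thesis
    using that h by blast
qed

text \<open>A subdirect embedding of \<open>A / \<theta>\<close> separates the classes of \<open>c\<close> and \<open>d\<close> in some factor. The kernel of the
  induced homomorphism from \<open>A\<close> to that factor contains \<open>\<theta>\<close> and omits \<open>(c, d)\<close>, hence equals \<open>\<theta>\<close>.\<close>

lemma subdirectly_irreducible_quotient:
  assumes A: "is_algebra \<Sigma> A" and \<theta>: "max_omitting \<Sigma> A c d \<theta>" and B: "is_algebra \<Sigma> B"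
    and h: "h \<in> hom \<Sigma> A B" "h ` carrier A = carrier B"
    and ker: "\<And>x y. x \<in> carrier A \<Longrightarrow> y \<in> carrier A \<Longrightarrow> h x = h y \<longleftrightarrow> (x, y) \<in> \<theta>"
  shows "subdirectly_irreducible \<Sigma> B"
  unfolding subdirectly_irreducible_def
proof (intro conjI allI impI B)
  fix I :: "'c rel set" and C :: "'c rel \<Rightarrow> ('a, 'c) algebra" and e
  assume sd: "subdirect_embedding \<Sigma> B I C e"
  then have e: "e \<in> hom \<Sigma> B (product_algebra I C)" "inj_on e (carrier B)"
    and onto: "\<And>i. i \<in> I \<Longrightarrow> (\<lambda>x. e x i) ` carrier B = carrier (C i)"
    by (auto simp: subdirect_embedding_def)
  have cd: "c \<in> carrier A" "d \<in> carrier A" "(c, d) \<notin> \<theta>"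
    using \<theta> by (auto simp: max_omitting_def)
  have hcd: "h c \<in> carrier B" "h d \<in> carrier B" "h c \<noteq> h d"
    using cd ker homD(1)[OF h(1)] by auto
  then have "e (h c) \<noteq> e (h d)"
    using e(2) by (auto dest: inj_onD)
  moreover have "e (h c) \<in> (\<Pi>\<^sub>E i\<in>I. carrier (C i))" "e (h d) \<in> (\<Pi>\<^sub>E i\<in>I. carrier (C i))"
    using homD(1)[OF e(1)] hcd by (auto simp: product_algebra_def)
  ultimately obtain i where i: "i \<in> I" "e (h c) i \<noteq> e (h d) i"
    using PiE_ext by metis
  have proj: "(\<lambda>x. e x i) \<in> hom \<Sigma> B (C i)"
    unfolding hom_def
  proof (intro CollectI conjI ballI)
    show "(\<lambda>x. e x i) ` carrier B \<subseteq> carrier (C i)"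
      using onto[OF i(1)] by simp
    fix f xs assume f: "f \<in> syms \<Sigma>" and xs: "xs \<in> args \<Sigma> f (carrier B)"
    then have "e (interp B f xs) = interp (product_algebra I C) f (map e xs)"
      using homD(2)[OF e(1)] by (auto simp: args_def)
    then show "e (interp B f xs) i = interp (C i) f (map (\<lambda>x. e x i) xs)"
      using i(1) by (simp add: product_algebra_def comp_def)
  qed
  have comp: "(\<lambda>x. e (h x) i) \<in> hom \<Sigma> A (C i)"
    unfolding hom_def
  proof (intro CollectI conjI ballI)
    show "(\<lambda>x. e (h x) i) ` carrier A \<subseteq> carrier (C i)"
      using homD(1)[OF h(1)] homD(1)[OF proj] by blast
    fix f xs assume f: "f \<in> syms \<Sigma>" and xs: "xs \<in> args \<Sigma> f (carrier A)"
    have "h (interp A f xs) = interp B f (map h xs)"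
      using homD(2)[OF h(1) f] xs by (auto simp: args_def)
    moreover have "set (map h xs) \<subseteq> carrier B"
      using xs homD(1)[OF h(1)] by (auto simp: args_def)
    ultimately show "e (h (interp A f xs)) i = interp (C i) f (map (\<lambda>x. e (h x) i) xs)"
      using homD(2)[OF proj f, of "map h xs"] xs by (simp add: args_def comp_def)
  qed
  let ?\<psi> = "{(x, y). x \<in> carrier A \<and> y \<in> carrier A \<and> e (h x) i = e (h y) i}"
  have "congruence \<Sigma> A ?\<psi>"
    by (rule congruence_kernel[OF A comp])
  moreover have "\<theta> \<subseteq> ?\<psi>"
    using congruenceD(1)[of \<Sigma> A \<theta>] \<theta> ker unfolding max_omitting_def by fastforce
  ultimately have "?\<psi> = \<theta>"
    using \<theta> i(2) unfolding max_omitting_def by blast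
  have "inj_on (\<lambda>x. e x i) (carrier B)"
  proof (rule inj_onI)
    fix u v assume "u \<in> carrier B" "v \<in> carrier B" and eq: "e u i = e v i"
    then obtain x y where "x \<in> carrier A" "y \<in> carrier A" "u = h x" "v = h y"
      using h(2) by (metis imageE)
    moreover from this have "(x, y) \<in> \<theta>"
      using eq unfolding \<open>?\<psi> = \<theta>\<close>[symmetric] by simp
    ultimately show "u = v"
      using ker by simp
  qed
  then have "(\<lambda>x. e x i) \<in> iso \<Sigma> B (C i)"
    using proj onto[OF i(1)] by (simp add: iso_def bij_betw_def)
  then show "\<exists>i\<in>I. (\<lambda>x. e x i) \<in> iso \<Sigma> B (C i)"
    using i(1) by blast
qed

text \<open>Residual smallness with the bound as a parameter.\<close>

definition bounds_si :: "'u rel \<Rightarrow> 'f signature \<Rightarrow> ('f trm \<times> 'f trm) set \<Rightarrow> bool" where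
  "bounds_si \<rho> \<Sigma> E \<longleftrightarrow> Card_order \<rho> \<and> lang_card \<Sigma> \<le>o \<rho> \<and> \<rho> <o |UNIV :: 'u set| \<and>
     (\<forall>B \<in> (variety \<Sigma> E :: ('f, 'u) algebra set).
        subdirectly_irreducible \<Sigma> B \<longrightarrow> |carrier B| \<le>o \<rho>)"

text \<open>The bound, assumed only for algebras on the type \<open>'u\<close>, holds for algebras on all types: if there
  were more than \<open>\<rho>\<close> classes, a subalgebra of size \<open>\<rho>\<^sup>+\<close> containing \<open>\<rho>\<^sup>+\<close> incongruent elements would
  have a quotient that fits on \<open>'u\<close> and violates the bound there.\<close>

lemma bounds_si_max_omitting:
  fixes \<rho> :: "'u rel" and A :: "('f, 'a) algebra"
  assumes \<rho>: "bounds_si \<rho> \<Sigma> E" and E: "E \<subseteq> identities \<Sigma>" and A: "A \<in> variety \<Sigma> E"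
    and \<theta>: "max_omitting \<Sigma> A c d \<theta>"
  shows "|carrier A // \<theta>| \<le>o \<rho>"
proof (rule ccontr)
  assume "\<not> |carrier A // \<theta>| \<le>o \<rho>"
  have C\<rho>: "Cinfinite \<rho>" "lang_card \<Sigma> \<le>o \<rho>" "\<rho> <o |UNIV :: 'u set|"
    using \<rho> cinfinite_mono[of "lang_card \<Sigma>" \<rho>] Cinfinite_lang_card by (auto simp: bounds_si_def)
  let ?\<mu> = "cardSuc \<rho>"
  have \<mu>: "Cinfinite ?\<mu>" "lang_card \<Sigma> \<le>o ?\<mu>" "?\<mu> \<le>o |UNIV :: 'u set|"
    using C\<rho> by (simp_all add: Cinfinite_cardSuc cardSuc_least card_of_Card_order
        ordLeq_transitive[OF C\<rho>(2) cardSuc_ordLeq])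
  have cong: "congruence \<Sigma> A \<theta>" and alg: "is_algebra \<Sigma> A"
    using \<theta> A by (auto simp: max_omitting_def variety_def)
  obtain R where R: "R \<subseteq> carrier A" "|R| =o |carrier A // \<theta>|"
    "\<And>x y. x \<in> R \<Longrightarrow> y \<in> R \<Longrightarrow> (x, y) \<in> \<theta> \<Longrightarrow> x = y"
    using transversal[OF cong] by blast
  have "?\<mu> \<le>o |carrier A // \<theta>|"
    using \<open>\<not> |carrier A // \<theta>| \<le>o \<rho>\<close> C\<rho>(1) by (intro cardSuc_ordLeq_if_not_ordLeq) auto
  then have "?\<mu> \<le>o |R|"
    using ordIso_symmetric[OF R(2)] by (rule ordLeq_ordIso_trans)
  moreover have Field: "|Field ?\<mu>| =o ?\<mu>"
    using \<mu>(1) card_of_Field_ordIso by blast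
  ultimately have "|Field ?\<mu>| \<le>o |R|"
    by (rule ordIso_ordLeq_trans[rotated])
  then obtain X where X: "X \<subseteq> R" "|Field ?\<mu>| =o |X|"
    by (auto dest: internalize_card_of_ordLeq2[THEN iffD1])
  have X\<mu>: "|X| =o ?\<mu>"
    using ordIso_symmetric[OF X(2)] Field by (rule ordIso_transitive)
  obtain Y where Y: "X \<subseteq> Y" "|Y| \<le>o ?\<mu>" "subuniverse \<Sigma> A Y"
    "max_omitting \<Sigma> (A\<lparr>carrier := Y\<rparr>) c d (\<theta> \<inter> Y \<times> Y)"
    using max_omitting_small_subalgebra[OF alg \<theta> subset_trans[OF X(1) R(1)]
        ordIso_imp_ordLeq[OF X\<mu>] \<mu>(1,2)] by metis
  let ?A = "A\<lparr>carrier := Y\<rparr>" and ?\<theta> = "\<theta> \<inter> Y \<times> Y"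
  have A': "?A \<in> variety \<Sigma> E" "is_algebra \<Sigma> ?A" "congruence \<Sigma> ?A ?\<theta>"
    using variety_subuniverse[OF A Y(3)] Y(4) by (auto simp: variety_def max_omitting_def)
  have "carrier ?A // ?\<theta> \<subseteq> (\<lambda>x. ?\<theta> `` {x}) ` Y"
    by (auto simp: quotient_def)
  then have "|carrier ?A // ?\<theta>| \<le>o |Y|"
    by (rule surj_imp_ordLeq)
  then have "|carrier ?A // ?\<theta>| \<le>o |UNIV :: 'u set|"
    by (rule ordLeq_transitive[OF _ ordLeq_transitive[OF Y(2) \<mu>(3)]])
  then obtain B :: "('f, 'u) algebra" and h where B: "h \<in> hom \<Sigma> ?A B" "h ` carrier ?A = carrier B"
    "\<And>x y. x \<in> carrier ?A \<Longrightarrow> y \<in> carrier ?A \<Longrightarrow> h x = h y \<longleftrightarrow> (x, y) \<in> ?\<theta>"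
    using quotient_copy[OF A'(2,3)] by metis
  have "B \<in> variety \<Sigma> E"
    by (rule variety_hom_image[OF A'(1) E B(1,2)])
  moreover from this have "subdirectly_irreducible \<Sigma> B"
    by (intro subdirectly_irreducible_quotient[OF A'(2) Y(4) _ B]) (auto simp: variety_def)
  ultimately have "|carrier B| \<le>o \<rho>"
    using \<rho> by (auto simp: bounds_si_def)
  moreover have "|X| \<le>o |carrier B|"
  proof (rule card_of_ordLeqI)
    show "inj_on h X"
    proof (rule inj_onI)
      fix x y assume xy: "x \<in> X" "y \<in> X" "h x = h y"
      then have "(x, y) \<in> \<theta>"
        using B(3)[of x y] Y(1) by auto
      then show "x = y"
        using R(3) xy X(1) by blast
    qed
    show "h x \<in> carrier B" if "x \<in> X" for x
      using that Y(1) B(2) by auto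
  qed
  ultimately have "?\<mu> \<le>o \<rho>"
    by (rule ordIso_ordLeq_trans[OF ordIso_symmetric[OF X\<mu>] ordLeq_transitive, rotated])
  then show False
    using cardSuc_greater[of \<rho>] C\<rho>(1) not_ordLess_ordLeq[of \<rho> ?\<mu>] by simp
qed


section \<open>Reduced powers\<close>

text \<open>The congruence on the power of \<open>A\<close> whose quotient is the reduced power of \<open>A / \<theta>\<close> by the filter \<open>F\<close>.\<close>

definition eventually_congruent :: "'i filter \<Rightarrow> ('f, 'a) algebra \<Rightarrow> 'a rel \<Rightarrow> ('i \<Rightarrow> 'a) rel" where
  "eventually_congruent F A \<theta> =
     {(g, h). range g \<subseteq> carrier A \<and> range h \<subseteq> carrier A \<and> (\<forall>\<^sub>F i in F. (g i, h i) \<in> \<theta>)}"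

lemma congruence_eventually:
  fixes A :: "('f, 'a) algebra" and F :: "'i filter"
  assumes A: "is_algebra \<Sigma> A" and \<theta>: "congruence \<Sigma> A \<theta>"
  shows "congruence \<Sigma> (product_algebra UNIV (\<lambda>_. A)) (eventually_congruent F A \<theta>)"
    (is "congruence _ ?P ?\<Theta>")
proof (rule congruenceI)
  show sub: "?\<Theta> \<subseteq> carrier ?P \<times> carrier ?P"
    by (auto simp: eventually_congruent_def carrier_power)
  show "(g, g) \<in> ?\<Theta>" if "g \<in> carrier ?P" for g
  proof -
    have "(g i, g i) \<in> \<theta>" for i
      using that congruenceD(2)[OF \<theta>] by (auto simp: carrier_power)
    then show ?thesis
      using that by (simp add: eventually_congruent_def carrier_power)
  qed
  show "(h, g) \<in> ?\<Theta>" if "(g, h) \<in> ?\<Theta>" for g h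
    using that congruenceD(3)[OF \<theta>]
    by (auto simp: eventually_congruent_def elim: eventually_mono)
  show "(g, k) \<in> ?\<Theta>" if "(g, h) \<in> ?\<Theta>" "(h, k) \<in> ?\<Theta>" for g h k
  proof -
    have "\<forall>\<^sub>F i in F. (g i, h i) \<in> \<theta>" "\<forall>\<^sub>F i in F. (h i, k i) \<in> \<theta>"
      using that by (auto simp: eventually_congruent_def)
    then have "\<forall>\<^sub>F i in F. (g i, k i) \<in> \<theta>"
      by eventually_elim (rule congruenceD(4)[OF \<theta>])
    then show ?thesis
      using that by (auto simp: eventually_congruent_def)
  qed
  fix f gs hs assume f: "f \<in> syms \<Sigma>" "length gs = arity \<Sigma> f"
    and l: "list_all2 (\<lambda>g h. (g, h) \<in> ?\<Theta>) gs hs"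
  have len: "length hs = arity \<Sigma> f"
    using f l list_all2_lengthD by fastforce
  have "interp A f (map (\<lambda>g. g i) ks) \<in> carrier A"
    if "length ks = arity \<Sigma> f" "\<And>k. k \<in> set ks \<Longrightarrow> range k \<subseteq> carrier A" for ks :: "('i \<Rightarrow> 'a) list" and i
  proof -
    have "map (\<lambda>g. g i) ks \<in> args \<Sigma> f (carrier A)"
      using that by (auto simp: args_def)
    then show ?thesis
      using A f(1) by (simp add: is_algebra_def)
  qed
  moreover have "range k \<subseteq> carrier A" if "k \<in> set gs \<union> set hs" for k
    using that list_all2_args[OF l sub] by (auto simp: carrier_power[symmetric])
  ultimately have in_A: "range (interp ?P f gs) \<subseteq> carrier A" "range (interp ?P f hs) \<subseteq> carrier A"
    using f(2) len by (auto simp: interp_power)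
  have "\<forall>\<^sub>F i in F. \<forall>n\<in>{..<length gs}. ((gs ! n) i, (hs ! n) i) \<in> \<theta>"
    using l by (auto simp: eventually_ball_finite_distrib list_all2_conv_all_nth eventually_congruent_def)
  then have "\<forall>\<^sub>F i in F. (interp ?P f gs i, interp ?P f hs i) \<in> \<theta>"
  proof eventually_elim
    case (elim i)
    then have "list_all2 (\<lambda>x y. (x, y) \<in> \<theta>) (map (\<lambda>g. g i) gs) (map (\<lambda>g. g i) hs)"
      using f(2) len by (auto simp: list_all2_conv_all_nth)
    then show ?case
      using congruenceD(5)[OF \<theta> f(1)] f(2) by (simp add: interp_power)
  qed
  with in_A show "(interp ?P f gs, interp ?P f hs) \<in> ?\<Theta>"
    by (simp add: eventually_congruent_def)
qed

text \<open>Derivations carry over from the coordinates to a reduced power: the intermediate elements are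
  chosen in each coordinate where the derivation exists and arbitrarily elsewhere. This is the part
  of the theorem of Los on ultraproducts that holds for all filters, because a derivation shape
  only asserts the existence of elements satisfying equations.\<close>

lemma derives_eventually:
  fixes A :: "('f, 'a) algebra" and F :: "'i filter"
  assumes A: "is_algebra \<Sigma> A" and \<theta>: "congruence \<Sigma> A \<theta>"
    and F: "F \<noteq> bot"
    and \<Theta>: "congruence \<Sigma> (product_algebra UNIV (\<lambda>_. A)) \<Theta>" (is "congruence _ ?P _")
      "eventually_congruent F A \<theta> \<subseteq> \<Theta>" "(g, h) \<in> \<Theta>"
    and "range u \<subseteq> carrier A" "range v \<subseteq> carrier A"
    and "\<forall>\<^sub>F i in F. derives \<Sigma> A \<theta> (g i) (h i) p (u i) (v i)"
  shows "(u, v) \<in> \<Theta>"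
proof -
  have gh: "range g \<subseteq> carrier A" "range h \<subseteq> carrier A"
    using congruenceD(1)[OF \<Theta>(1)] \<Theta>(3) by (auto simp: carrier_power[symmetric])
  have in_A: "a \<in> carrier A \<and> b \<in> carrier A" if "derives \<Sigma> A \<theta> (g i) (h i) p a b" for i p a b
    using derives_carrier[OF that A congruenceD(1)[OF \<theta>]] gh by auto
  have ev: "(a, b) \<in> \<Theta>"
    if "range a \<subseteq> carrier A" "range b \<subseteq> carrier A" "\<forall>\<^sub>F i in F. (a i, b i) \<in> \<theta>" for a b
    using that \<Theta>(2) by (auto simp: eventually_congruent_def)
  have ev_eq: "(a, b) \<in> \<Theta>"
    if "range a \<subseteq> carrier A" "range b \<subseteq> carrier A" "\<forall>\<^sub>F i in F. a i = b i" for a b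
  proof (rule ev[OF that(1,2)])
    show "\<forall>\<^sub>F i in F. (a i, b i) \<in> \<theta>"
      using that(3) by eventually_elim (use that(2) congruenceD(2)[OF \<theta>] in auto)
  qed
  show ?thesis
    using assms(7-)
  proof (induction p arbitrary: u v)
    case Given
    have "\<forall>\<^sub>F i in F. u i = g i" "\<forall>\<^sub>F i in F. h i = v i"
      using Given(3) by (auto elim!: eventually_mono elim: derives_elims)
    then have "(u, g) \<in> \<Theta>" "(h, v) \<in> \<Theta>"
      using ev_eq Given(1,2) gh by blast+
    then show ?case
      using \<Theta>(3) congruenceD(4)[OF \<Theta>(1)] by blast
  next
    case Modulo
    have "\<forall>\<^sub>F i in F. (u i, v i) \<in> \<theta>"
      using Modulo(3) by (auto elim!: eventually_mono elim: derives_elims)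
    then show ?case
      using ev Modulo(1,2) by blast
  next
    case (Flip p)
    have "\<forall>\<^sub>F i in F. derives \<Sigma> A \<theta> (g i) (h i) p (v i) (u i)"
      using Flip.prems(3) by (auto elim!: eventually_mono elim: derives_elims)
    then show ?case
      using Flip congruenceD(3)[OF \<Theta>(1)] by blast
  next
    case (Join p q)
    define joins where "joins i w \<longleftrightarrow>
      derives \<Sigma> A \<theta> (g i) (h i) p (u i) w \<and> derives \<Sigma> A \<theta> (g i) (h i) q w (v i)" for i w
    define w where "w i = (if \<exists>a. joins i a then SOME a. joins i a else u i)" for i
    have w: "joins i (w i)" if "\<exists>a. joins i a" for i
      using that someI_ex[OF that] by (simp add: w_def)
    have "w i \<in> carrier A" for i
    proof (cases "\<exists>a. joins i a")
      case True
      then show ?thesis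
        using w in_A unfolding joins_def by blast
    qed (use Join.prems(1) in \<open>auto simp: w_def\<close>)
    then have "range w \<subseteq> carrier A"
      by blast
    moreover have "\<forall>\<^sub>F i in F. joins i (w i)"
      using Join.prems(3)
    proof eventually_elim
      case (elim i)
      then have "\<exists>a. joins i a"
        by (auto simp: joins_def elim: derives_elims)
      then show ?case
        by (rule w)
    qed
    ultimately have "(u, w) \<in> \<Theta>" "(w, v) \<in> \<Theta>"
      using Join.IH(1)[of u w] Join.IH(2)[of w v] Join.prems(1,2)
      by (simp_all add: joins_def eventually_conj_iff)
    then show ?case
      using congruenceD(4)[OF \<Theta>(1)] by blast
  next
    case (Apply f ps)
    define applies where "applies i z \<longleftrightarrow> (case z of (as, bs) \<Rightarrow>
      f \<in> syms \<Sigma> \<and> length as = arity \<Sigma> f \<and> length bs = length as \<and> length ps = length as \<and>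
      (\<forall>n<length as. derives \<Sigma> A \<theta> (g i) (h i) (ps ! n) (as ! n) (bs ! n)) \<and>
      u i = interp A f as \<and> v i = interp A f bs)" for i z
    have ev_ex: "\<forall>\<^sub>F i in F. \<exists>z. applies i z"
      using Apply.prems(3)
    proof eventually_elim
      case (elim i)
      then show ?case
      proof (cases rule: derives.cases)
        case (Apply as bs)
        then have "applies i (as, bs)"
          by (simp add: applies_def)
        then show ?thesis ..
      qed
    qed
    \<comment> \<open>As \<open>F\<close> is proper, the derivation exists in some coordinate; so \<open>f\<close> is a symbol of the right arity.\<close>
    then obtain i0 z0 where "applies i0 z0"
      using eventually_happens[OF ev_ex] F by blast
    then have f: "f \<in> syms \<Sigma>" "length ps = arity \<Sigma> f"
      by (auto simp: applies_def split: prod.splits)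
    define z where "z i = (SOME z. applies i z)" for i
    have z: "applies i (z i)" if "\<exists>z. applies i z" for i
      using someI_ex[OF that] by (simp add: z_def)
    define a where "a n i = (if \<exists>z. applies i z then fst (z i) ! n else u i)" for n i
    define b where "b n i = (if \<exists>z. applies i z then snd (z i) ! n else v i)" for n i
    let ?as = "map a [0..<arity \<Sigma> f]" and ?bs = "map b [0..<arity \<Sigma> f]"
    have ab: "derives \<Sigma> A \<theta> (g i) (h i) (ps ! n) (a n i) (b n i)"
      if "\<exists>z. applies i z" "n < arity \<Sigma> f" for i n
      using z[OF that(1)] that by (auto simp: a_def b_def applies_def split: prod.splits)
    have ab_in: "range (a n) \<subseteq> carrier A" "range (b n) \<subseteq> carrier A" if n: "n < arity \<Sigma> f" for n
    proof -
      have "a n i \<in> carrier A \<and> b n i \<in> carrier A" for i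
      proof (cases "\<exists>z. applies i z")
        case True
        then show ?thesis
          using ab[OF True n] in_A by blast
      next
        case False
        then show ?thesis
          using Apply.prems(1,2) by (auto simp: a_def b_def)
      qed
      then show "range (a n) \<subseteq> carrier A" "range (b n) \<subseteq> carrier A"
        by blast+
    qed
    have "(a n, b n) \<in> \<Theta>" if n: "n < arity \<Sigma> f" for n
    proof (rule Apply.IH)
      show "ps ! n \<in> set ps"
        using n f by simp
      show "\<forall>\<^sub>F i in F. derives \<Sigma> A \<theta> (g i) (h i) (ps ! n) (a n i) (b n i)"
        using ev_ex by eventually_elim (rule ab[OF _ n])
    qed (use ab_in n in auto)
    then have "list_all2 (\<lambda>g h. (g, h) \<in> \<Theta>) ?as ?bs"
      by (simp add: list_all2_conv_all_nth)
    then have *: "(interp ?P f ?as, interp ?P f ?bs) \<in> \<Theta>"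
      using congruenceD(5)[OF \<Theta>(1) f(1)] by simp
    then have "range (interp ?P f ?as) \<subseteq> carrier A" "range (interp ?P f ?bs) \<subseteq> carrier A"
      using congruenceD(1)[OF \<Theta>(1)] by (auto simp: carrier_power[symmetric])
    moreover have "\<forall>\<^sub>F i in F. u i = interp ?P f ?as i \<and> interp ?P f ?bs i = v i"
      using ev_ex
    proof eventually_elim
      case (elim i)
      obtain xs ys where zi: "z i = (xs, ys)"
        by force
      have len: "length xs = arity \<Sigma> f" "length ys = arity \<Sigma> f" "u i = interp A f xs" "v i = interp A f ys"
        using z[OF elim] by (auto simp: applies_def zi)
      have "map (\<lambda>g. g i) ?as = xs"
        by (rule nth_equalityI) (use elim len in \<open>simp_all add: a_def zi\<close>)
      moreover have "map (\<lambda>g. g i) ?bs = ys"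
        by (rule nth_equalityI) (use elim len in \<open>simp_all add: b_def zi\<close>)
      ultimately show ?case
        using len by (simp only: interp_power simp_thms)
    qed
    ultimately have "(u, interp ?P f ?as) \<in> \<Theta>" "(interp ?P f ?bs, v) \<in> \<Theta>"
      using Apply.prems(1,2) by (auto intro!: ev_eq elim: eventually_mono)
    then show ?case
      using * congruenceD(4)[OF \<Theta>(1)] by blast
  qed
qed

text \<open>The form of Taylor's theorem that is needed. The reduced power is taken over the finite sets \<open>J\<close> of
  elements of \<open>\<rho>\<^sup>+\<close>. An element \<open>x\<close> of \<open>\<rho>\<^sup>+\<close> gives the point of the power whose coordinate at \<open>J\<close> is \<open>s n\<close>,
  where \<open>n\<close> is the number of elements of \<open>J\<close> below \<open>x\<close>. If \<open>x < y\<close>, then this number is smaller for \<open>x\<close>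
  than for \<open>y\<close> whenever \<open>x \<in> J\<close>, and \<open>p\<close> derives \<open>(c, d)\<close> from the two coordinates.\<close>

lemma max_omitting_few_classes:
  fixes \<rho> :: "'u rel" and A :: "('f, 'a) algebra"
  assumes \<rho>: "bounds_si \<rho> \<Sigma> E" and E: "E \<subseteq> identities \<Sigma>" and A: "A \<in> variety \<Sigma> E"
    and \<theta>: "max_omitting \<Sigma> A c d \<theta>"
  shows "|carrier A // \<theta>| \<le>o ctwo ^c cardSuc (lang_card \<Sigma>)"
proof (rule ccontr)
  assume big: "\<not> ?thesis"
  have cong: "congruence \<Sigma> A \<theta>" and alg: "is_algebra \<Sigma> A"
    and cd: "c \<in> carrier A" "d \<in> carrier A" "(c, d) \<notin> \<theta>"
    using \<theta> A by (auto simp: max_omitting_def variety_def)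
  obtain R where R: "R \<subseteq> carrier A" "|R| =o |carrier A // \<theta>|"
    "\<And>x y. x \<in> R \<Longrightarrow> y \<in> R \<Longrightarrow> (x, y) \<in> \<theta> \<Longrightarrow> x = y"
    using transversal[OF cong] by metis
  have bigR: "\<not> |R| \<le>o ctwo ^c cardSuc (lang_card \<Sigma>)"
  proof
    assume "|R| \<le>o ctwo ^c cardSuc (lang_card \<Sigma>)"
    then have "|carrier A // \<theta>| \<le>o ctwo ^c cardSuc (lang_card \<Sigma>)"
      by (rule ordIso_ordLeq_trans[OF ordIso_symmetric[OF R(2)]])
    with big show False
      by simp
  qed
  \<comment> \<open>Colour a pair by the shape of a derivation of \<open>(c, d)\<close> from it.\<close>
  define col where "col x y = (SOME p. derives \<Sigma> A \<theta> x y p c d)" for x y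
  have col: "derives \<Sigma> A \<theta> x y (col x y) c d" if "x \<in> R" "y \<in> R" "x \<noteq> y" for x y
  proof -
    have "(x, y) \<notin> \<theta>"
      using that R(3) by blast
    then have "\<exists>p. derives \<Sigma> A \<theta> x y p c d"
      using max_omitting_derives[OF alg \<theta>] that(1,2) R(1) by (metis subsetD)
    then show ?thesis
      unfolding col_def by (rule someI_ex)
  qed
  have shape: "\<And>x y. x \<in> R \<Longrightarrow> y \<in> R \<Longrightarrow> x \<noteq> y \<Longrightarrow> col x y \<in> shapes \<Sigma>"
    by (rule derives_shapes[OF col])
  obtain p and s :: "nat \<Rightarrow> 'a" where s: "range s \<subseteq> R"
    "\<And>i j. i < j \<Longrightarrow> s i \<noteq> s j \<and> col (s i) (s j) = p"
    by (rule weak_Erdos_Rado[OF Cinfinite_lang_card card_of_shapes _ bigR, where col = col]) (rule shape that, assumption+)+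
  have p: "derives \<Sigma> A \<theta> (s i) (s j) p c d" if "i < j" for i j
    using col[of "s i" "s j"] s(2)[OF that] s(1) by auto
  let ?r = "cardSuc \<rho>"
  have C\<rho>: "Card_order \<rho>"
    using \<rho> by (simp add: bounds_si_def)
  interpret wo_rel ?r
    using cardSuc_Well_order[OF C\<rho>] by (simp add: wo_rel_def)
  let ?X = "Field ?r"
  let ?F = "finite_subsets_at_top ?X"
  let ?P = "product_algebra (UNIV :: 'u set set set) (\<lambda>_. A)"
  define b where "b x = (\<lambda>J. s (card {z \<in> J. z \<in> Order_Relation.underS ?r x}))" for x
  have b: "range (b x) \<subseteq> carrier A" for x
    using s(1) R(1) by (auto simp: b_def)
  have F: "?F \<noteq> bot"
    by (simp add: finite_subsets_at_top_neq_bot)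
  have "((\<lambda>_. c), (\<lambda>_. d)) \<notin> eventually_congruent ?F A \<theta>"
    using cd F by (simp add: eventually_congruent_def)
  moreover have "(\<lambda>_. c) \<in> carrier ?P" "(\<lambda>_. d) \<in> carrier ?P"
    using cd by (auto simp: carrier_power)
  ultimately obtain \<Theta> where \<Theta>: "eventually_congruent ?F A \<theta> \<subseteq> \<Theta>" "max_omitting \<Sigma> ?P (\<lambda>_. c) (\<lambda>_. d) \<Theta>"
    by (rule max_omitting_exists[OF congruence_eventually[OF alg cong]]) (rule that)
  then have cong': "congruence \<Sigma> ?P \<Theta>" "((\<lambda>_. c), (\<lambda>_. d)) \<notin> \<Theta>"
    by (auto simp: max_omitting_def)
  have separated: "(b x, b y) \<notin> \<Theta>" if xy: "x \<in> Order_Relation.underS ?r y" for x y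
  proof
    assume "(b x, b y) \<in> \<Theta>"
    have "x \<in> ?X"
      using xy by (auto simp: Order_Relation.underS_def Field_def)
    have "\<forall>\<^sub>F J in ?F. derives \<Sigma> A \<theta> (b x J) (b y J) p c d"
      unfolding eventually_finite_subsets_at_top
    proof (intro exI[of _ "{x}"] conjI allI impI)
      fix J assume J: "finite J \<and> {x} \<subseteq> J \<and> J \<subseteq> ?X"
      have "x \<notin> {z \<in> J. z \<in> Order_Relation.underS ?r x}"
        by (auto simp: Order_Relation.underS_def)
      moreover have "x \<in> {z \<in> J. z \<in> Order_Relation.underS ?r y}"
        using xy J by blast
      moreover have "Order_Relation.underS ?r x \<subseteq> Order_Relation.underS ?r y"
        using xy TRANS ANTISYM unfolding Order_Relation.underS_def by (auto dest: transD antisymD)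
      ultimately have "{z \<in> J. z \<in> Order_Relation.underS ?r x} \<subset> {z \<in> J. z \<in> Order_Relation.underS ?r y}"
        by blast
      then show "derives \<Sigma> A \<theta> (b x J) (b y J) p c d"
        unfolding b_def using J by (intro p psubset_card_mono) auto
    qed (use \<open>x \<in> ?X\<close> in auto)
    then have "((\<lambda>_. c), (\<lambda>_. d)) \<in> \<Theta>"
      using cd by (intro derives_eventually[OF alg cong F cong'(1) \<Theta>(1) \<open>(b x, b y) \<in> \<Theta>\<close>]) auto
    with cong'(2) show False ..
  qed
  have inj: "x = y" if "x \<in> ?X" "y \<in> ?X" "(b x, b y) \<in> \<Theta>" for x y
  proof (rule ccontr)
    assume "x \<noteq> y"
    then have "x \<in> Order_Relation.underS ?r y \<or> y \<in> Order_Relation.underS ?r x"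
      using TOTALS that(1,2) by (auto simp: Order_Relation.underS_def)
    then show False
      using separated that(3) congruenceD(3)[OF cong'(1) that(3)] by blast
  qed
  have "|?X| \<le>o |carrier ?P // \<Theta>|"
  proof (rule card_of_ordLeqI)
    show "inj_on (\<lambda>x. \<Theta> `` {b x}) ?X"
      using inj b congruence_class_eq_iff[OF cong'(1)] by (intro inj_onI) (simp add: carrier_power)
    show "\<Theta> `` {b x} \<in> carrier ?P // \<Theta>" for x
      using b by (auto intro!: quotientI simp: carrier_power)
  qed
  also have "|carrier ?P // \<Theta>| \<le>o \<rho>"
    by (rule bounds_si_max_omitting[OF \<rho> E variety_power[OF A] \<Theta>(2)])
  finally have "|?X| \<le>o \<rho>" .
  then have "?r \<le>o \<rho>"
    by (rule ordIso_ordLeq_trans[OF ordIso_symmetric[OF card_of_Field_ordIso[OF cardSuc_Card_order[OF C\<rho>]]]])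
  then show False
    using cardSuc_greater[OF C\<rho>] not_ordLess_ordLeq[of \<rho> ?r] by simp
qed


section \<open>Large subalgebras\<close>

lemma subuniverse_saturation:
  assumes \<theta>: "congruence \<Sigma> A \<theta>" and G: "subuniverse \<Sigma> A G"
  shows "subuniverse \<Sigma> A (\<theta> `` G)"
  unfolding subuniverse_def
proof (intro conjI ballI)
  show "\<theta> `` G \<subseteq> carrier A"
    using congruenceD(1)[OF \<theta>] by auto
  fix f xs assume f: "f \<in> syms \<Sigma>" and xs: "xs \<in> args \<Sigma> f (\<theta> `` G)"
  then have "\<forall>x\<in>set xs. \<exists>z\<in>G. (z, x) \<in> \<theta>"
    by (auto simp: args_def)
  then obtain k where k: "\<And>x. x \<in> set xs \<Longrightarrow> k x \<in> G \<and> (k x, x) \<in> \<theta>"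
    by metis
  then have "map k xs \<in> args \<Sigma> f G"
    using xs by (auto simp: args_def)
  then have "interp A f (map k xs) \<in> G"
    using G f by (simp add: subuniverse_def)
  moreover have "list_all2 (\<lambda>x y. (x, y) \<in> \<theta>) (map k xs) xs"
    using k by (simp add: list_all2_conv_all_nth)
  then have "(interp A f (map k xs), interp A f xs) \<in> \<theta>"
    using congruenceD(5)[OF \<theta> f] xs by (simp add: args_def)
  ultimately show "interp A f xs \<in> \<theta> `` G"
    by blast
qed

text \<open>The classes that meet a small subalgebra containing \<open>c\<close> form a subalgebra. It contains the class of
  \<open>c\<close> and therefore has full size, so it is all of \<open>A\<close>, and every class meets the small subalgebra.\<close>

lemma few_classes_if_no_large_subuniverse:
  assumes A: "is_algebra \<Sigma> A" and \<theta>: "congruence \<Sigma> A \<theta>"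
    and no: "\<And>Y. subuniverse \<Sigma> A Y \<Longrightarrow> |Y| =o |carrier A| \<Longrightarrow> Y = carrier A"
    and c: "c \<in> carrier A" "|\<theta> `` {c}| =o |carrier A|"
  shows "|carrier A // \<theta>| \<le>o lang_card \<Sigma>"
proof -
  obtain G where G: "subuniverse \<Sigma> A G" "c \<in> G" "|G| \<le>o lang_card \<Sigma>"
    using small_subuniverse[OF A c(1)] by metis
  have sat: "subuniverse \<Sigma> A (\<theta> `` G)"
    by (rule subuniverse_saturation[OF \<theta> G(1)])
  have "|carrier A| \<le>o |\<theta> `` G|"
    by (rule ordIso_ordLeq_trans[OF ordIso_symmetric[OF c(2)] card_of_mono1]) (use G(2) in auto)
  moreover have "|\<theta> `` G| \<le>o |carrier A|"
    using sat by (intro card_of_mono1) (simp add: subuniverse_def)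
  ultimately have eq: "\<theta> `` G = carrier A"
    by (intro no[OF sat]) (simp add: ordIso_iff_ordLeq)
  have "carrier A // \<theta> \<subseteq> (\<lambda>z. \<theta> `` {z}) ` G"
  proof
    fix C assume "C \<in> carrier A // \<theta>"
    then obtain x where x: "x \<in> carrier A" "C = \<theta> `` {x}"
      by (auto elim: quotientE)
    then obtain z where z: "z \<in> G" "(z, x) \<in> \<theta>"
      using eq by blast
    then have "\<theta> `` {z} = \<theta> `` {x}"
      using congruence_class_eq_iff[OF \<theta> _ x(1), of z] congruenceD(1)[OF \<theta>] by blast
    then show "C \<in> (\<lambda>z. \<theta> `` {z}) ` G"
      using z x by blast
  qed
  then show ?thesis
    by (rule ordLeq_transitive[OF surj_imp_ordLeq G(3)])
qed

theorem theorem3p2: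
  fixes \<Sigma> :: "'f signature"
    and J :: "('f, 'a) algebra"
    and E :: "('f trm \<times> 'f trm) set"
  assumes "is_algebra \<Sigma> J"
    and "ctwo ^c cardSuc (lang_card \<Sigma>) <o cofinality |carrier J|"
    and "E \<subseteq> identities \<Sigma>"
    and "residually_small TYPE('u) \<Sigma> E"
    and "J \<in> variety \<Sigma> E"
  shows "\<exists>B. proper_subalgebra \<Sigma> B J \<and> |carrier B| =o |carrier J|"
proof (rule ccontr)
  assume none: "\<not> ?thesis"
  let ?L = "cardSuc (lang_card \<Sigma>)"
  let ?M = "ctwo ^c ?L"
  have no: "Y = carrier J" if Y: "subuniverse \<Sigma> J Y" "|Y| =o |carrier J|" for Y
  proof (rule ccontr)
    assume "Y \<noteq> carrier J"
    with Y(1) have "proper_subalgebra \<Sigma> (J\<lparr>carrier := Y\<rparr>) J"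
      by (auto simp: proper_subalgebra_def is_subalgebra_def is_algebra_def subuniverse_def)
    with none Y(2) show False
      by auto
  qed
  obtain \<rho> :: "'u rel" where \<rho>: "bounds_si \<rho> \<Sigma> E"
    using assms(4) unfolding residually_small_def bounds_si_def by blast
  have L: "Cinfinite ?L" "?L \<le>o ?M" "Cinfinite ?M"
  proof -
    show L: "Cinfinite ?L"
      by (rule Cinfinite_cardSuc[OF Cinfinite_lang_card])
    show "?L \<le>o ?M"
      using L by (intro ordLess_imp_ordLeq ordLess_ctwo_cexp) simp
    then show "Cinfinite ?M"
      using L cinfinite_mono Card_order_cexp by blast
  qed
  \<comment> \<open>Coarse congruences collapse: one class is as large as \<open>J\<close>, by cofinality.\<close>
  have collapse: "|carrier J // \<theta>| \<le>o lang_card \<Sigma>"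
    if \<theta>: "congruence \<Sigma> J \<theta>" "|carrier J // \<theta>| \<le>o ?M" for \<theta>
  proof -
    have "\<exists>C\<in>carrier J // \<theta>. \<not> |C| <o |carrier J|"
    proof (rule ccontr)
      assume "\<not> ?thesis"
      then have "|\<Union>C\<in>carrier J // \<theta>. C| <o |carrier J|"
        by (intro card_of_UNION_ordLess_cofinality[OF card_of_Card_order L(3) assms(2) \<theta>(2)]) auto
      moreover have "(\<Union>C\<in>carrier J // \<theta>. C) = carrier J"
        using \<theta>(1) Union_quotient unfolding congruence_def by auto
      ultimately show False
        using ordLess_irreflexive[of "|carrier J|"] by simp
    qed
    then obtain c where c: "c \<in> carrier J" "\<not> |\<theta> `` {c}| <o |carrier J|"
      by (auto elim!: quotientE)
    have "|\<theta> `` {c}| \<le>o |carrier J|"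
      using congruenceD(1)[OF \<theta>(1)] by (intro card_of_mono1) auto
    with c(2) have "|\<theta> `` {c}| =o |carrier J|"
      using ordLeq_iff_ordLess_or_ordIso by blast
    then show ?thesis
      using few_classes_if_no_large_subuniverse[OF assms(1) \<theta>(1) no c(1)] by blast
  qed
  have "?L \<le>o |carrier J|"
    using ordLeq_transitive[OF L(2) ordLess_imp_ordLeq[OF ordLess_ordLeq_trans[OF assms(2)
          cofinality_ordLeq_self[OF card_of_Card_order]]]] .
  moreover have FL: "|Field ?L| =o ?L"
    using L(1) card_of_Field_ordIso by blast
  ultimately have "|Field ?L| \<le>o |carrier J|"
    by (rule ordIso_ordLeq_trans[rotated])
  then obtain Z where Z: "Z \<subseteq> carrier J" "|Field ?L| =o |Z|"
    by (auto dest: internalize_card_of_ordLeq2[THEN iffD1])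
  have ZL: "|Z| =o ?L"
    by (rule ordIso_transitive[OF ordIso_symmetric[OF Z(2)] FL])
  have "\<exists>\<theta>. max_omitting \<Sigma> J x y \<theta>" if "x \<in> Z" "y \<in> Z" "x \<noteq> y" for x y
  proof -
    have "x \<in> carrier J" "y \<in> carrier J" "(x, y) \<notin> Id_on (carrier J)"
      using that Z(1) by auto
    then show ?thesis
      using max_omitting_exists[OF congruence_Id_on[OF assms(1)]] by metis
  qed
  then obtain \<theta> where \<theta>: "\<And>x y. x \<in> Z \<Longrightarrow> y \<in> Z \<Longrightarrow> x \<noteq> y \<Longrightarrow> max_omitting \<Sigma> J x y (\<theta> x y)"
    by metis
  \<comment> \<open>A coarse congruence for each pair of elements of \<open>Z\<close>; their intersection separates \<open>Z\<close>.\<close>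
  define I where "I = {(x, y). x \<in> Z \<and> y \<in> Z \<and> x \<noteq> y}"
  let ?\<psi> = "\<Inter>i\<in>I. \<theta> (fst i) (snd i)"
  have \<theta>I: "congruence \<Sigma> J (\<theta> (fst i) (snd i))" "|carrier J // \<theta> (fst i) (snd i)| \<le>o ?M"
    if "i \<in> I" for i
  proof -
    have max: "max_omitting \<Sigma> J (fst i) (snd i) (\<theta> (fst i) (snd i))"
      using that by (intro \<theta>) (auto simp: I_def)
    then show "congruence \<Sigma> J (\<theta> (fst i) (snd i))"
      by (simp add: max_omitting_def)
    show "|carrier J // \<theta> (fst i) (snd i)| \<le>o ?M"
      by (rule max_omitting_few_classes[OF \<rho> assms(3,5) max])
  qed
  have "infinite Z"
    using card_of_ordIso_finite[OF Z(2)] L(1) by (simp add: cinfinite_def)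
  then obtain x where x: "x \<in> Z"
    using infinite_imp_nonempty by blast
  have "Z - {x} \<noteq> {}"
    using \<open>infinite Z\<close> by (metis finite.emptyI infinite_remove)
  with x have "I \<noteq> {}"
    by (auto simp: I_def)
  have "|I| \<le>o |Z \<times> Z|"
    by (rule card_of_mono1) (auto simp: I_def)
  also have "|Z \<times> Z| \<le>o ?L"
    using cprod_cinfinite_bound[OF ordIso_imp_ordLeq[OF ZL] ordIso_imp_ordLeq[OF ZL]
        card_of_Card_order card_of_Card_order L(1)]
    by (simp add: cprod_def Field_card_of)
  finally have few: "|carrier J // ?\<psi>| \<le>o ?M"
    by (rule card_of_quotient_INT[OF L(1) _ \<open>I \<noteq> {}\<close> \<theta>I])
  have cong: "congruence \<Sigma> J ?\<psi>"
    by (rule congruence_INT[OF \<open>I \<noteq> {}\<close> \<theta>I(1)])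
  have "|carrier J // ?\<psi>| \<le>o lang_card \<Sigma>"
    by (rule collapse[OF cong few])
  moreover have "|Z| \<le>o |carrier J // ?\<psi>|"
  proof (rule card_of_quotient_ordLeq[OF cong Z(1)])
    fix x y assume xy: "x \<in> Z" "y \<in> Z" "(x, y) \<in> ?\<psi>"
    show "x = y"
    proof (rule ccontr)
      assume "x \<noteq> y"
      with xy have "(x, y) \<in> I"
        by (simp add: I_def)
      with xy(3) have "(x, y) \<in> \<theta> x y"
        by fastforce
      with \<theta>[OF xy(1,2) \<open>x \<noteq> y\<close>] show False
        by (simp add: max_omitting_def)
    qed
  qed
  ultimately have "?L \<le>o lang_card \<Sigma>"
    using ordIso_ordLeq_trans[OF ordIso_symmetric[OF ZL] ordLeq_transitive] by blast
  then show False
    using cardSuc_greater[of "lang_card \<Sigma>"] Cinfinite_lang_card[of \<Sigma>]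
      not_ordLess_ordLeq[of "lang_card \<Sigma>" ?L] by simp
qed

end
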